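(* Let $p$ be a prime, let $\mathbb F$ be a field of characteristic $p$, and let $\lambda=0\in\mathbb F^p$. If $p=2$, then $$H^2_*(\mathfrak m_0^0(2))\cong C^2_*(\mathfrak m_0^0(2))=\operatorname{span}(\{(0,\overline e^1),(0,\overline e^2),(e^{1,2},\tilde e^{1,2})\})$$ is $3$-dimensional. If $p\ge 3$, then $$\dim H^2_*(\mathfrak m_0^0(p))=\frac{3p+1}{2},$$ and the cohomology classes of $$\{(0,\overline e^1),\dots,(0,\overline e^p),(e^{1,p},\tilde e^{1,p}),(\phi_5,\tilde\phi_5),(\phi_7,\tilde\phi_7),\dots,(\phi_{p+2},\tilde\phi_{p+2})\}$$ form a basis, where for odd $k$ with $5\le k\le p+2$, $\phi_k=\sum_{i=2}^{\lfloor k/2\rfloor}(-1)^ie^{i,k-i}$.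
   Context: Let $\mathbb F$ be a field of characteristic $p>0$. $\mathfrak m_0(p)$ is the Lie algebra over $\mathbb F$ with basis $e_1,\dots,e_p$ and brackets $[e_1,e_i]=-[e_i,e_1]=e_{i+1}$ for $1<i<p$, all other brackets of basis elements being $0$. For $\lambda=(\lambda_1,\dots,\lambda_p)\in\mathbb F^p$, $\mathfrak m_0^\lambda(p)$ denotes $\mathfrak m_0(p)$ with the restricted structure $\left(\sum_k\alpha_ke_k\right)^{[p]}=\left(\sum_k\alpha_k^p\lambda_k\right)e_p$. Write $\mathfrak g=\mathfrak m_0^\lambda(p)$. Ordinary cochains (trivial coefficients $\mathbb F$): $C^n(\mathfrak g)=(\wedge^n\mathfrak g)^*$; $\{e^k\}$ is the basis of $\mathfrak g^*$ dual to $\{e_k\}$, and $\{e^{i,j}:1\le i<j\le p\}$ is the basis of $C^2(\mathfrak g)$ dual to $\{e_i\wedge e_j\}$. Differentials: $d^1(\psi)(g,h)=\psi([g,h])$ and $d^2(\phi)(g,h,f)=\phi([g,h]\wedge f)-\phi([g,f]\wedge h)+\phi([h,f]\wedge g)$. Restricted cochains: $C^1_*(\mathfrak g)=\mathfrak g^*$. For $\phi\in C^2(\mathfrak g)$, a map $\omega:\mathfrak g\to\mathbb F$ has the $*$-property with respect to $\phi$ if $\omega(\alpha g)=\alpha^p\omega(g)$ for $\alpha\in\mathbb F$, and for all $g,h\in\mathfrak g$ $$\omega(g+h)=\omega(g)+\omega(h)+\sum\frac{1}{\#(g)}\,\phi([g_1,g_2,\dots,g_{p-1}]\wedge g_p),$$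 the sum being over all formal sequences $(g_1,\dots,g_p)$ with each $g_i$ equal to $g$ or $h$, $g_1=g$, $g_2=h$; $\#(g)$ is the number of positions filled with $g$, and $[g_1,\dots,g_j]=[[\cdots[[g_1,g_2],g_3],\dots],g_j]$ (with $[g_1]=g_1$). Given $\phi$, the values of such $\omega$ on the basis $e_1,\dots,e_p$ can be prescribed arbitrarily and determine $\omega$. $C^2_*(\mathfrak g)$ is the vector space of pairs $(\phi,\omega)$ with $\phi\in C^2(\mathfrak g)$ and $\omega$ having the $*$-property with respect to $\phi$. Put $\overline e^k\left(\sum_i\alpha_ie_i\right)=\alpha_k^p$, and for $\phi\in C^2(\mathfrak g)$ let $\tilde\phi$ be the map with the $*$-property with respect to $\phi$ that vanishes on $e_1,\dots,e_p$; $\tilde e^{i,j}$ is this map for $\phi=e^{i,j}$. Restricted differentials: $d^1_*(\psi)=(d^1\psi,\operatorname{ind}^1(\psi))$ with $\operatorname{ind}^1(\psi)(g)=\psi(g^{[p]})$, and $d^2_*(\phi,\omega)=(d^2\phi,\operatorname{ind}^2(\phi,\omega))$, where $\operatorname{ind}^2(\phi,\omega):\mathfrak g\times\mathfrak g\to\mathbb F$ is $\operatorname{ind}^2(\phi,\omega)(g,h)=\phi(g\wedge h^{[p]})$. Thus $\ker d^2_*$ consists of the pairs with $d^2\phi=0$ and $\operatorname{ind}^2(\phi,\omega)=0$, and $H^2_*(\mathfrak g)=\ker d^2_*/\operatorname{im}d^1_*$. *)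

theory Defs
  imports
    "HOL-Computational_Algebra.Computational_Algebra"
    "HOL-Library.Function_Algebras"
    "HOL-Library.Product_Plus"
begin

text \<open>
  The field \<open>\<bbbF>\<close> is the type \<open>'a\<close>, and the characteristic \<open>p\<close> is \<open>CHAR('a)\<close>.  As \<open>p\<close> is determined by
  the field, the Lie algebra \<open>\<mm>\<^sub>0(p)\<close> over \<open>\<bbbF>\<close> is a type that depends on \<open>'a\<close> only: its elements are
  the coordinate vectors with respect to \<open>e\<^sub>1, \<dots>, e\<^sub>p\<close>, i.e. functions supported on \<open>{1..p}\<close>.
\<close>

typedef (overloaded) 'a m0 = "{x :: nat \<Rightarrow> 'a::field. \<forall>i. i \<notin> {1..CHAR('a)} \<longrightarrow> x i = 0}"
  morphisms coord Abs_m0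
  by (rule exI[of _ "\<lambda>_. 0"]) simp

setup_lifting type_definition_m0

instantiation m0 :: (field) ab_group_add
begin
lift_definition zero_m0 :: "'a m0" is "\<lambda>_. 0" by simp
lift_definition plus_m0 :: "'a m0 \<Rightarrow> 'a m0 \<Rightarrow> 'a m0" is "\<lambda>x y i. x i + y i" by simp
lift_definition minus_m0 :: "'a m0 \<Rightarrow> 'a m0 \<Rightarrow> 'a m0" is "\<lambda>x y i. x i - y i" by simp
lift_definition uminus_m0 :: "'a m0 \<Rightarrow> 'a m0" is "\<lambda>x i. - x i" by simp
instance by standard (transfer; simp add: fun_eq_iff algebra_simps)+
end

lift_definition m0_scale :: "'a::field \<Rightarrow> 'a m0 \<Rightarrow> 'a m0" is "\<lambda>c x i. c * x i" by simp

lift_definition e :: "nat \<Rightarrow> 'a::field m0"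
  is "\<lambda>k i. if i = k \<and> k \<in> {1..CHAR('a)} then 1 else 0" by auto

global_interpretation m0: vector_space "m0_scale :: 'a::field \<Rightarrow> 'a m0 \<Rightarrow> 'a m0"
  by standard (transfer; simp add: fun_eq_iff algebra_simps)+

definition bracket :: "'a::field m0 \<Rightarrow> 'a m0 \<Rightarrow> 'a m0" where
  "bracket x y =
     (\<Sum>i | 1 < i \<and> i < CHAR('a). m0_scale (coord x 1 * coord y i - coord x i * coord y 1) (e (i + 1)))"

definition pmap :: "(nat \<Rightarrow> 'a::field) \<Rightarrow> 'a m0 \<Rightarrow> 'a m0" where
  "pmap lam x = m0_scale (\<Sum>k = 1..CHAR('a). coord x k ^ CHAR('a) * lam k) (e CHAR('a))"

text \<open>\<open>[g\<^sub>1, \<dots>, g\<^sub>j] = [[\<dots>[[g\<^sub>1, g\<^sub>2], g\<^sub>3], \<dots>], g\<^sub>j]\<close>, for a nonempty list.\<close>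

definition left_bracket :: "'a::field m0 list \<Rightarrow> 'a m0" where
  "left_bracket gs = foldl bracket (hd gs) (tl gs)"


text \<open>
  An element \<open>\<phi>\<close> of \<open>C\<^sup>2 = (\<and>\<^sup>2 \<gg>)\<^sup>*\<close> is an alternating bilinear form; \<open>\<phi>(g \<and> h)\<close> is written \<open>\<phi> g h\<close>.
\<close>

definition C1 :: "('a::field m0 \<Rightarrow> 'a) set" where
  "C1 = {\<psi>. Vector_Spaces.linear m0_scale (*) \<psi>}"

definition C2 :: "('a::field m0 \<Rightarrow> 'a m0 \<Rightarrow> 'a) set" where
  "C2 = {\<phi>. (\<forall>h. Vector_Spaces.linear m0_scale (*) (\<lambda>g. \<phi> g h)) \<and>
             (\<forall>g. Vector_Spaces.linear m0_scale (*) (\<phi> g)) \<and>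
             (\<forall>g. \<phi> g g = 0)}"

definition e2 :: "nat \<Rightarrow> nat \<Rightarrow> 'a::field m0 \<Rightarrow> 'a m0 \<Rightarrow> 'a" where
  "e2 i j g h = coord g i * coord h j - coord g j * coord h i"

definition d1 :: "('a::field m0 \<Rightarrow> 'a) \<Rightarrow> 'a m0 \<Rightarrow> 'a m0 \<Rightarrow> 'a" where
  "d1 \<psi> g h = \<psi> (bracket g h)"

definition d2 :: "('a::field m0 \<Rightarrow> 'a m0 \<Rightarrow> 'a) \<Rightarrow> 'a m0 \<Rightarrow> 'a m0 \<Rightarrow> 'a m0 \<Rightarrow> 'a" where
  "d2 \<phi> g h f = \<phi> (bracket g h) f - \<phi> (bracket g f) h + \<phi> (bracket h f) g"


text \<open>
  A formal sequence \<open>(g\<^sub>1, \<dots>, g\<^sub>p)\<close> with entries \<open>g\<close> or \<open>h\<close> is encoded by the list \<open>s\<close> of booleans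
  with \<open>True\<close> at the positions filled with \<open>g\<close>; so \<open>g\<^sub>1 = g\<close> and \<open>g\<^sub>2 = h\<close> become \<open>s ! 0\<close> and \<open>\<not> s ! 1\<close>.
\<close>

definition star_sum :: "('a::field m0 \<Rightarrow> 'a m0 \<Rightarrow> 'a) \<Rightarrow> 'a m0 \<Rightarrow> 'a m0 \<Rightarrow> 'a" where
  "star_sum \<phi> g h =
     (\<Sum>s | length s = CHAR('a) \<and> s ! 0 \<and> \<not> s ! 1.
        let gs = map (\<lambda>b. if b then g else h) s
        in 1 / of_nat (count_list s True) * \<phi> (left_bracket (butlast gs)) (last gs))"

definition star_property :: "('a::field m0 \<Rightarrow> 'a m0 \<Rightarrow> 'a) \<Rightarrow> ('a m0 \<Rightarrow> 'a) \<Rightarrow> bool" where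
  "star_property \<phi> \<omega> \<longleftrightarrow>
     (\<forall>c g. \<omega> (m0_scale c g) = c ^ CHAR('a) * \<omega> g) \<and>
     (\<forall>g h. \<omega> (g + h) = \<omega> g + \<omega> h + star_sum \<phi> g h)"

type_synonym 'a cochain2 = "('a m0 \<Rightarrow> 'a m0 \<Rightarrow> 'a) \<times> ('a m0 \<Rightarrow> 'a)"

definition scale2 :: "'a::field \<Rightarrow> 'a cochain2 \<Rightarrow> 'a cochain2" where
  "scale2 c x = ((\<lambda>g h. c * fst x g h), (\<lambda>g. c * snd x g))"

global_interpretation cochain2: vector_space "scale2 :: 'a::field \<Rightarrow> 'a cochain2 \<Rightarrow> 'a cochain2"
  by standard (simp_all add: scale2_def prod_eq_iff fun_eq_iff algebra_simps)

definition C2_res :: "'a::field cochain2 set" where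
  "C2_res = {(\<phi>, \<omega>). \<phi> \<in> C2 \<and> star_property \<phi> \<omega>}"

definition ebar :: "nat \<Rightarrow> 'a::field m0 \<Rightarrow> 'a" where
  "ebar k g = coord g k ^ CHAR('a)"

definition tilde :: "('a::field m0 \<Rightarrow> 'a m0 \<Rightarrow> 'a) \<Rightarrow> 'a m0 \<Rightarrow> 'a" where
  "tilde \<phi> = (THE \<omega>. star_property \<phi> \<omega> \<and> (\<forall>k \<in> {1..CHAR('a)}. \<omega> (e k) = 0))"

definition ind1 :: "(nat \<Rightarrow> 'a::field) \<Rightarrow> ('a m0 \<Rightarrow> 'a) \<Rightarrow> 'a m0 \<Rightarrow> 'a" where
  "ind1 lam \<psi> g = \<psi> (pmap lam g)"

definition ind2 :: "(nat \<Rightarrow> 'a::field) \<Rightarrow> 'a cochain2 \<Rightarrow> 'a m0 \<Rightarrow> 'a m0 \<Rightarrow> 'a" where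
  "ind2 lam x g h = fst x g (pmap lam h)"

definition d1_res :: "(nat \<Rightarrow> 'a::field) \<Rightarrow> ('a m0 \<Rightarrow> 'a) \<Rightarrow> 'a cochain2" where
  "d1_res lam \<psi> = (d1 \<psi>, ind1 lam \<psi>)"

definition d2_res :: "(nat \<Rightarrow> 'a::field) \<Rightarrow> 'a cochain2 \<Rightarrow>
    ('a m0 \<Rightarrow> 'a m0 \<Rightarrow> 'a m0 \<Rightarrow> 'a) \<times> ('a m0 \<Rightarrow> 'a m0 \<Rightarrow> 'a)" where
  "d2_res lam x = (d2 (fst x), ind2 lam x)"

definition Z2_res :: "(nat \<Rightarrow> 'a::field) \<Rightarrow> 'a cochain2 set" where
  "Z2_res lam = {x \<in> C2_res. d2_res lam x = 0}"

definition B2_res :: "(nat \<Rightarrow> 'a::field) \<Rightarrow> 'a cochain2 set" where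
  "B2_res lam = d1_res lam ` C1"

definition \<phi>_odd :: "nat \<Rightarrow> 'a::field m0 \<Rightarrow> 'a m0 \<Rightarrow> 'a" where
  "\<phi>_odd k g h = (\<Sum>i = 2..k div 2. (-1) ^ i * e2 i (k - i) g h)"


lemma coord_simps [simp]:
  "coord 0 i = 0" "coord (x + y) i = coord x i + coord y i"
  "coord (x - y) i = coord x i - coord y i" "coord (- x) i = - coord x i"
  "coord (m0_scale c x) i = c * coord x i"
  by (transfer; simp)+

lemma coord_sum: "coord (sum f A) i = (\<Sum>a\<in>A. coord (f a) i)"
  by (induction A rule: infinite_finite_induct) auto

lemma coord_e:
  "coord (e k :: 'a::field m0) i = (if i = k \<and> k \<in> {1..CHAR('a)} then 1 else 0)"
  by transfer simp

lemma coord_outside: "i \<notin> {1..CHAR('a)} \<Longrightarrow> coord (x :: 'a::field m0) i = 0"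
  by transfer blast

lemma m0_eqI: "(\<And>i. coord x i = coord y i) \<Longrightarrow> x = y"
  by transfer auto

lemma coord_bracket:
  "coord (bracket x y :: 'a::field m0) j =
     (if 3 \<le> j \<and> j \<le> CHAR('a) then coord x 1 * coord y (j - 1) - coord x (j - 1) * coord y 1 else 0)"
proof -
  have "coord (bracket x y) j = (\<Sum>i | 1 < i \<and> i < CHAR('a).
      if i = j - 1 then (if 1 \<le> j then coord x 1 * coord y (j - 1) - coord x (j - 1) * coord y 1 else 0) else 0)"
    unfolding bracket_def coord_sum
    by (rule sum.cong) (auto simp: coord_e)
  also have "\<dots> = (if 3 \<le> j \<and> j \<le> CHAR('a) then coord x 1 * coord y (j - 1) - coord x (j - 1) * coord y 1 else 0)"
    by (subst sum.delta) auto
  finally show ?thesis .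
qed

lemma bracket_e1:
  assumes "1 < i" "i < CHAR('a::field)"
  shows "bracket (e 1) (e i) = (e (i + 1) :: 'a m0)" and "bracket (e i) (e 1) = - (e (i + 1) :: 'a m0)"
  by (rule m0_eqI; use assms in \<open>auto simp: coord_bracket coord_e\<close>)+

lemma bracket_e_eq_0:
  assumes "i \<noteq> 1 \<or> j = 1 \<or> CHAR('a::field) \<le> j" "j \<noteq> 1 \<or> i = 1 \<or> CHAR('a) \<le> i"
  shows "bracket (e i) (e j) = (0 :: 'a m0)"
  by (rule m0_eqI; use assms in \<open>auto simp: coord_bracket coord_e\<close>)

lemma linear_m0_iff:
  "Vector_Spaces.linear m0_scale (*) (f :: 'a::field m0 \<Rightarrow> 'a) \<longleftrightarrow>
     (\<forall>x y. f (x + y) = f x + f y) \<and> (\<forall>c x. f (m0_scale c x) = c * f x)"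
proof -
  have "vector_space ((*) :: 'a \<Rightarrow> 'a \<Rightarrow> 'a)"
    by standard (simp_all add: algebra_simps)
  thus ?thesis
    unfolding Vector_Spaces.linear_iff using m0.vector_space_axioms by blast
qed

lemma subspace_C2_res: "cochain2.subspace (C2_res :: 'a::field cochain2 set)"
proof -
  have "star_sum (\<phi> + \<phi>') g h = star_sum \<phi> g h + star_sum \<phi>' g h"
    for \<phi> \<phi>' :: "'a m0 \<Rightarrow> 'a m0 \<Rightarrow> 'a" and g h
    by (simp add: star_sum_def Let_def algebra_simps sum.distrib add_divide_distrib)
  moreover have "star_sum (\<lambda>g h. c * \<phi> g h) g h = c * star_sum \<phi> g h"
    for c :: 'a and \<phi> g h
    by (simp add: star_sum_def Let_def sum_distrib_left mult_ac)
  moreover have "star_sum 0 g h = (0 :: 'a)" for g h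
    by (simp add: star_sum_def Let_def)
  ultimately show ?thesis
    unfolding cochain2.subspace_def C2_res_def C2_def linear_m0_iff star_property_def
    by (auto simp: scale2_def zero_prod_def algebra_simps)
qed

lemma subspace_Z2_res: "cochain2.subspace (Z2_res lam)"
proof -
  have "d2_res lam (x + y) = d2_res lam x + d2_res lam y" for x y :: "'a cochain2"
    by (simp add: d2_res_def d2_def ind2_def fun_eq_iff algebra_simps)
  moreover have "d2_res lam 0 = 0"
    by (simp add: d2_res_def d2_def ind2_def fun_eq_iff zero_prod_def)
  moreover have "d2_res lam (scale2 c x) = 0" if "d2_res lam x = 0" for c x
  proof -
    have "d2_res lam (scale2 c x) =
        ((\<lambda>g h f. c * d2 (fst x) g h f), (\<lambda>g h. c * ind2 lam x g h))"
      by (simp add: d2_res_def d2_def ind2_def scale2_def fun_eq_iff algebra_simps)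
    thus ?thesis
      using that by (simp add: d2_res_def zero_prod_def fun_eq_iff)
  qed
  ultimately show ?thesis
    using subspace_C2_res unfolding Z2_res_def cochain2.subspace_def
    by (simp del: split_paired_All split_paired_Ex) blast
qed

lemma subspace_B2_res: "cochain2.subspace (B2_res lam)"
proof (unfold cochain2.subspace_def, intro conjI ballI allI)
  have "0 \<in> C1" "d1_res lam 0 = 0"
    by (simp_all add: C1_def linear_m0_iff d1_res_def d1_def ind1_def fun_eq_iff zero_prod_def)
  thus "0 \<in> B2_res lam"
    unfolding B2_res_def by (metis image_eqI)
next
  fix x y :: "'a cochain2"
  assume "x \<in> B2_res lam" "y \<in> B2_res lam"
  then obtain \<psi> \<psi>' where *: "\<psi> \<in> C1" "\<psi>' \<in> C1" "x = d1_res lam \<psi>" "y = d1_res lam \<psi>'"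
    unfolding B2_res_def by blast
  hence "\<psi> + \<psi>' \<in> C1" "x + y = d1_res lam (\<psi> + \<psi>')"
    by (simp_all add: C1_def linear_m0_iff d1_res_def d1_def ind1_def fun_eq_iff algebra_simps)
  thus "x + y \<in> B2_res lam"
    unfolding B2_res_def by blast
next
  fix c and x :: "'a cochain2"
  assume "x \<in> B2_res lam"
  then obtain \<psi> where *: "\<psi> \<in> C1" "x = d1_res lam \<psi>"
    unfolding B2_res_def by blast
  hence "(\<lambda>g. c * \<psi> g) \<in> C1" "scale2 c x = d1_res lam (\<lambda>g. c * \<psi> g)"
    by (simp_all add: C1_def linear_m0_iff d1_res_def d1_def ind1_def scale2_def fun_eq_iff algebra_simps)
  thus "scale2 c x \<in> B2_res lam"
    unfolding B2_res_def by blast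
qed

lemma coord_left_bracket:
  assumes "2 \<le> length gs" "j \<le> length gs"
  shows "coord (left_bracket gs) j = 0"
  using assms
proof (induction gs arbitrary: j rule: rev_induct)
  case (snoc x gs)
  show ?case
  proof (cases "length gs = 1")
    case True
    then obtain y where "gs = [y]"
      by (auto simp: length_Suc_conv)
    thus ?thesis
      using snoc.prems by (simp add: left_bracket_def coord_bracket)
  next
    case False
    hence "2 \<le> length gs"
      using snoc.prems by auto
    hence "coord (left_bracket gs) 1 = 0" "j - 1 \<le> length gs \<Longrightarrow> coord (left_bracket gs) (j - 1) = 0"
      using snoc.IH by auto
    moreover have "left_bracket (gs @ [x]) = bracket (left_bracket gs) x"
      using \<open>2 \<le> length gs\<close> by (cases gs) (auto simp: left_bracket_def)
    ultimately show ?thesis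
      using snoc.prems by (simp add: coord_bracket)
  qed
qed simp

lemma B2_res_subset_Z2_res:
  assumes "CHAR('a::field) > 0"
  shows "B2_res (\<lambda>_. 0) \<subseteq> (Z2_res (\<lambda>_. 0) :: 'a cochain2 set)"
proof
  fix x :: "'a cochain2"
  assume "x \<in> B2_res (\<lambda>_. 0)"
  then obtain \<psi> where \<psi>: "\<psi> \<in> C1" and x: "x = d1_res (\<lambda>_. 0) \<psi>"
    unfolding B2_res_def by blast
  have p: "CHAR('a) \<ge> 2"
    using assms CHAR_not_1' by (metis One_nat_def Suc_1 Suc_leI le_neq_implies_less)
  have add: "\<psi> (g + h) = \<psi> g + \<psi> h" and scale: "\<psi> (m0_scale c g) = c * \<psi> g" for c g h
    using \<psi> by (auto simp: C1_def linear_m0_iff)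
  have zero: "\<psi> 0 = 0"
    using scale[of 0 0] by simp
  have diff: "\<psi> (g - h) = \<psi> g - \<psi> h" for g h
    using add[of "g - h" h] by (simp add: algebra_simps)
  have "star_sum (d1 \<psi>) g h = 0" for g h
    unfolding star_sum_def
  proof (rule sum.neutral, safe)
    fix s :: "bool list"
    assume s: "length s = CHAR('a)"
    define gs where "gs = map (\<lambda>b. if b then g else h) s"
    have len: "length gs = CHAR('a)"
      using s by (simp add: gs_def)
    obtain ys y where gs: "gs = ys @ [y]" "ys \<noteq> []"
      using p len by (cases gs rule: rev_cases) fastforce+
    have "bracket (left_bracket (butlast gs)) (last gs) = left_bracket gs"
      using gs by (cases ys) (auto simp: left_bracket_def)
    also have "left_bracket gs = 0"
    proof (rule m0_eqI)
      fix i show "coord (left_bracket gs) i = coord 0 i"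
        using coord_left_bracket[of gs i] coord_outside[of i "left_bracket gs"] p len
        by (cases "i \<le> CHAR('a)") auto
    qed
    finally show "(let gs = map (\<lambda>b. if b then g else h) s
        in 1 / of_nat (count_list s True) * d1 \<psi> (left_bracket (butlast gs)) (last gs)) = 0"
      unfolding gs_def[symmetric] by (simp add: Let_def d1_def zero)
  qed
  moreover have "pmap (\<lambda>_. 0) g = (0 :: 'a m0)" for g
    by (rule m0_eqI) (simp add: pmap_def)
  moreover have "bracket g g = 0" "bracket (g + g') h = bracket g h + bracket g' h"
    "bracket g (h + h') = bracket g h + bracket g h'"
    "bracket (m0_scale c g) h = m0_scale c (bracket g h)"
    "bracket g (m0_scale c h) = m0_scale c (bracket g h)" for g g' h h' :: "'a m0" and c
    by (rule m0_eqI; simp add: coord_bracket algebra_simps)+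
  moreover have "d2 (d1 \<psi>) g h f = 0" for g h f
  proof -
    have "bracket (bracket g h) f - bracket (bracket g f) h + bracket (bracket h f) g = 0"
      by (rule m0_eqI) (auto simp: coord_bracket algebra_simps)
    thus ?thesis
      by (simp add: d2_def d1_def zero flip: add diff)
  qed
  moreover have "bracket g 0 = 0" for g :: "'a m0"
    by (rule m0_eqI) (simp add: coord_bracket)
  ultimately show "x \<in> Z2_res (\<lambda>_. 0)"
    using assms unfolding x
    by (simp add: Z2_res_def C2_res_def C2_def star_property_def d1_res_def d2_res_def
        ind1_def ind2_def d1_def linear_m0_iff add scale zero zero_prod_def fun_eq_iff)
qed


text \<open>
  The quotient \<open>H\<^sup>2\<^sub>*(\<mm>\<^sub>0\<^sup>0(p)) = ker d\<^sup>2\<^sub>* / im d\<^sup>1\<^sub>*\<close>.  A type cannot depend on the parameter of the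
  restricted structure, so \<open>\<lambda> = 0\<close> is fixed here.  The abstraction function \<open>cohom_class\<close> sends a
  cocycle to its class (and is meaningless outside \<open>Z2_res (\<lambda>_. 0)\<close>).
\<close>

definition cohomologous :: "'a::field cochain2 \<Rightarrow> 'a cochain2 \<Rightarrow> bool" where
  "cohomologous x y \<longleftrightarrow>
     x \<in> Z2_res (\<lambda>_. 0) \<and> y \<in> Z2_res (\<lambda>_. 0) \<and> x - y \<in> B2_res (\<lambda>_. 0)"

quotient_type (overloaded) 'a H2_res = "'a::field cochain2" / partial: cohomologous
  morphisms Rep_H2_res cohom_class
proof (rule part_equivpI)
  show "\<exists>x :: 'a cochain2. cohomologous x x"
    using cochain2.subspace_0[OF subspace_Z2_res] cochain2.subspace_0[OF subspace_B2_res]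
    unfolding cohomologous_def by (metis diff_self)
  show "symp (cohomologous :: 'a cochain2 \<Rightarrow> _)"
    using cochain2.subspace_neg[OF subspace_B2_res]
    by (force simp: cohomologous_def symp_def)
  show "transp (cohomologous :: 'a cochain2 \<Rightarrow> _)"
    using cochain2.subspace_add[OF subspace_B2_res]
    by (force simp: cohomologous_def transp_def)
qed

lemma cohomologous_refl: "x \<in> Z2_res (\<lambda>_. 0) \<Longrightarrow> cohomologous x x"
  using cochain2.subspace_0[OF subspace_B2_res] by (auto simp: cohomologous_def)

instantiation H2_res :: (field) ab_group_add
begin

lift_definition zero_H2_res :: "'a H2_res" is 0
  by (intro cohomologous_refl cochain2.subspace_0 subspace_Z2_res)

lift_definition plus_H2_res :: "'a H2_res \<Rightarrow> 'a H2_res \<Rightarrow> 'a H2_res" is "(+)"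
  unfolding cohomologous_def add_diff_add
  by (blast intro: cochain2.subspace_add subspace_Z2_res subspace_B2_res)

lift_definition uminus_H2_res :: "'a H2_res \<Rightarrow> 'a H2_res" is uminus
  unfolding cohomologous_def minus_diff_minus
  by (blast intro: cochain2.subspace_neg subspace_Z2_res subspace_B2_res)

definition minus_H2_res :: "'a H2_res \<Rightarrow> 'a H2_res \<Rightarrow> 'a H2_res" where
  "minus_H2_res x y = x + - y"

instance
proof
  fix a b c :: "'a H2_res"
  show "a + b + c = a + (b + c)"
    by transfer (auto simp: add.assoc intro!: cohomologous_refl cochain2.subspace_add
        subspace_Z2_res simp: cohomologous_def)
  show "a + b = b + a"
    by transfer (auto simp: add.commute cohomologous_def cochain2.subspace_add
        cochain2.subspace_0 subspace_Z2_res subspace_B2_res)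
  show "0 + a = a"
    by transfer (simp add: cohomologous_def)
  show "- a + a = 0"
    by transfer (simp add: cohomologous_def cochain2.subspace_0 subspace_Z2_res subspace_B2_res)
  show "a - b = a + - b"
    by (rule minus_H2_res_def)
qed

end

lift_definition scale_H2 :: "'a::field \<Rightarrow> 'a H2_res \<Rightarrow> 'a H2_res" is scale2
  unfolding cohomologous_def cochain2.scale_right_diff_distrib[symmetric]
  by (blast intro: cochain2.subspace_scale subspace_Z2_res subspace_B2_res)

global_interpretation H2: vector_space "scale_H2 :: 'a::field \<Rightarrow> 'a H2_res \<Rightarrow> 'a H2_res"
proof
  fix a b :: 'a and x y :: "'a H2_res"
  show "scale_H2 a (x + y) = scale_H2 a x + scale_H2 a y"
    by transfer (auto simp: cochain2.scale_right_distrib cohomologous_def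
        intro!: cohomologous_refl cochain2.subspace_add cochain2.subspace_scale subspace_Z2_res)
  show "scale_H2 (a + b) x = scale_H2 a x + scale_H2 b x"
    by transfer (auto simp: cochain2.scale_left_distrib cohomologous_def
        intro!: cohomologous_refl cochain2.subspace_add cochain2.subspace_scale subspace_Z2_res)
  show "scale_H2 a (scale_H2 b x) = scale_H2 (a * b) x"
    by transfer (auto simp: cohomologous_def
        intro!: cohomologous_refl cochain2.subspace_scale subspace_Z2_res)
  show "scale_H2 1 x = x"
    by transfer simp
qed

lemma cohom_class_eq_iff:
  assumes "x \<in> Z2_res (\<lambda>_. 0)" "y \<in> Z2_res (\<lambda>_. 0)"
  shows "cohom_class x = cohom_class y \<longleftrightarrow> x - y \<in> B2_res (\<lambda>_. 0)"
  using Quotient_rel[OF Quotient_H2_res, of x y] cohomologous_refl[OF assms(1)]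
    cohomologous_refl[OF assms(2)] assms
  by (simp add: cohomologous_def)

end

theory Submission
  imports Defs
begin

text \<open>
  Since \<open>\<lambda> = 0\<close>, the condition on \<open>ind\<^sup>2\<close> is void, so a cocycle is a pair \<open>(\<phi>, \<omega>)\<close> with \<open>d\<^sup>2\<phi> = 0\<close>.
  On the basis, \<open>d\<^sup>2\<phi> = 0\<close> says that \<open>\<phi>(e\<^sub>i\<^sub>+\<^sub>1, e\<^sub>j) = - \<phi>(e\<^sub>i, e\<^sub>j\<^sub>+\<^sub>1)\<close> for \<open>i, j \<ge> 2\<close>, so on each antidiagonal
  \<open>i + j = k\<close> the values are determined by \<open>\<phi>(e\<^sub>2, e\<^sub>k\<^sub>-\<^sub>2)\<close>; they vanish if \<open>k\<close> is even, because then the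
  antidiagonal meets the diagonal, or if \<open>k > p + 2\<close>.

  If \<open>p \<ge> 3\<close>, all \<open>(p - 1)\<close>-fold brackets are multiples of \<open>e\<^sub>p\<close>, so the correction term of the
  \<open>*\<close>-property involves only \<open>\<phi>(e\<^sub>p, _)\<close>, and for a cocycle only \<open>\<alpha> = \<phi>(e\<^sub>1, e\<^sub>p)\<close> and \<open>\<beta> = \<phi>(e\<^sub>2, e\<^sub>p)\<close>.
  Grouping the sequences by the number of entries \<open>g\<close> gives binomial sums whose coefficients modulo \<open>p\<close>
  are, up to a factor \<open>\<plusminus>1/2\<close>, those of the polynomial \<open>((x + y)\<^sup>p\<^sup>-\<^sup>2 - x\<^sup>p\<^sup>-\<^sup>2) / y\<close>.  With
  \<open>(x + y)\<^sup>p = x\<^sup>p + y\<^sup>p\<close> one finds that \<open>\<alpha> g\<^sub>1\<^sup>p\<^sup>-\<^sup>1 g\<^sub>2 + \<beta> g\<^sub>1\<^sup>p\<^sup>-\<^sup>2 g\<^sub>2\<^sup>2 / 2\<close> has the \<open>*\<close>-property; it vanishes on the basis.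

  The functionals \<open>\<omega>(e\<^sub>k)\<close>, \<open>\<phi>(e\<^sub>1, e\<^sub>p)\<close> and \<open>\<phi>(e\<^sub>2, e\<^sub>k\<^sub>-\<^sub>2)\<close> kill the coboundaries and are dual to the claimed
  basis.  If all of them vanish on a cocycle \<open>(\<phi>, \<omega>)\<close>, then \<open>\<phi>\<close> is supported on the pairs \<open>(e\<^sub>1, e\<^sub>j)\<close> with
  \<open>j < p\<close>, so \<open>\<phi> = d\<^sup>1\<psi>\<close> for \<open>\<psi>(e\<^sub>j\<^sub>+\<^sub>1) = \<phi>(e\<^sub>1, e\<^sub>j)\<close>, and \<open>\<omega> = 0 = ind\<^sup>1(\<psi>)\<close>.
\<close>

section \<open>Binomial sums in characteristic \<open>p\<close>\<close>

lemma of_nat_below_CHAR_nonzero: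
  assumes "0 < k" "k < CHAR('a::semiring_1)"
  shows "of_nat k \<noteq> (0 :: 'a)"
  using assms by (auto simp: of_nat_eq_0_iff_char_dvd dest: dvd_imp_le)

lemma of_nat_CHAR_diff:
  assumes "k \<le> CHAR('a::ring_1)"
  shows "of_nat (CHAR('a) - k) = (- of_nat k :: 'a)"
  using assms by (simp add: of_nat_diff)

lemma two_nonzero_if_CHAR_ge_3:
  assumes "3 \<le> CHAR('a::semiring_1)"
  shows "(2 :: 'a) \<noteq> 0"
  using of_nat_below_CHAR_nonzero[where 'a='a, of 2] assms by simp

definition power_diff_quotient :: "nat \<Rightarrow> 'a::comm_ring_1 \<Rightarrow> 'a \<Rightarrow> 'a" where
  "power_diff_quotient n x y = (\<Sum>k<n. of_nat (n choose k) * x ^ k * y ^ (n - Suc k))"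

lemma mult_power_diff_quotient: "y * power_diff_quotient n x y = (x + y) ^ n - x ^ n"
proof -
  have "y * power_diff_quotient n x y = (\<Sum>k<n. of_nat (n choose k) * x ^ k * y ^ (n - k))"
    unfolding power_diff_quotient_def sum_distrib_left
    by (intro sum.cong refl) (auto simp: less_iff_Suc_add mult_ac)
  thus ?thesis
    unfolding binomial_ring lessThan_Suc_atMost[symmetric] by simp
qed

lemma power_diff_quotient_swap:
  "power_diff_quotient n y x = (\<Sum>k<n. of_nat (n choose Suc k) * x ^ k * y ^ (n - Suc k))"
proof -
  have "power_diff_quotient n y x =
      (\<Sum>k<n. of_nat (n choose (n - Suc k)) * y ^ (n - Suc k) * x ^ (n - Suc (n - Suc k)))"
    unfolding power_diff_quotient_def by (rule sum.nat_diff_reindex[symmetric])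
  also have "\<dots> = (\<Sum>k<n. of_nat (n choose Suc k) * x ^ k * y ^ (n - Suc k))"
    by (intro sum.cong refl) (simp add: mult_ac flip: binomial_symmetric)
  finally show ?thesis .
qed

lemma mult_power_diff_quotient_0: "x * power_diff_quotient n x 0 = of_nat n * x ^ n"
proof (cases n)
  case (Suc m)
  have "power_diff_quotient n x 0 = (\<Sum>k<n. if k = m then of_nat n * x ^ m else 0)"
    unfolding power_diff_quotient_def
    by (intro sum.cong refl) (auto simp: Suc power_0_left)
  thus ?thesis
    using Suc by (simp add: mult_ac)
qed (simp add: power_diff_quotient_def)

lemma power_diff_quotient_CHAR_minus_2_add:
  fixes x y :: "'a::field"
  assumes "prime CHAR('a)"
  defines "n \<equiv> CHAR('a) - 2"
  shows "x * power_diff_quotient n x y + y * power_diff_quotient n y x = - 2 * (x + y) ^ n"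
proof -
  have n: "CHAR('a) = n + 2"
    using prime_ge_2_nat[OF assms(1)] by (simp add: n_def)
  hence of_nat_n: "of_nat n = (- 2 :: 'a)"
    using of_nat_CHAR_diff[where 'a='a, of 2] by simp
  consider "x = 0" | "y = 0" | "x * y \<noteq> 0"
    by auto
  thus ?thesis
  proof cases
    case 3
    have "x * y * (x * power_diff_quotient n x y + y * power_diff_quotient n y x) =
        x\<^sup>2 * (y * power_diff_quotient n x y) + y\<^sup>2 * (x * power_diff_quotient n y x)"
      by (simp add: algebra_simps power2_eq_square)
    also have "\<dots> = (x\<^sup>2 + y\<^sup>2) * (x + y) ^ n - (x ^ (n + 2) + y ^ (n + 2))"
      unfolding mult_power_diff_quotient add.commute[of y x] power_add by (simp add: algebra_simps)
    also have "x ^ (n + 2) + y ^ (n + 2) = (x + y)\<^sup>2 * (x + y) ^ n"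
      using freshmans_dream[OF assms(1), of "n + 2" x y] n by (simp add: power2_eq_square mult_ac)
    also have "(x\<^sup>2 + y\<^sup>2) * (x + y) ^ n - (x + y)\<^sup>2 * (x + y) ^ n = x * y * (- 2 * (x + y) ^ n)"
      by (simp add: algebra_simps power2_eq_square)
    finally show ?thesis
      using 3 by (simp only: mult_cancel_left) simp
  qed (simp_all add: mult_power_diff_quotient_0 of_nat_n)
qed

lemma power_diff_quotient_CHAR_minus_2_diff:
  fixes x y :: "'a::field"
  assumes "prime CHAR('a)"
  defines "n \<equiv> CHAR('a) - 2"
  shows "x * (x * power_diff_quotient n x y - y * power_diff_quotient n y x) =
    2 * (y ^ Suc n - (x + y) ^ Suc n)"
proof -
  have "x * power_diff_quotient n x y - y * power_diff_quotient n y x =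
      - 2 * (x + y) ^ n - 2 * (y * power_diff_quotient n y x)"
    using power_diff_quotient_CHAR_minus_2_add[OF assms(1), of x y] by (simp add: n_def algebra_simps)
  hence "x * (x * power_diff_quotient n x y - y * power_diff_quotient n y x) =
      - 2 * (x * (x + y) ^ n) - 2 * (y * (x * power_diff_quotient n y x))"
    by (simp only:) (simp add: algebra_simps)
  also have "x * power_diff_quotient n y x = (x + y) ^ n - y ^ n"
    by (simp add: mult_power_diff_quotient add.commute)
  finally show ?thesis
    by (simp add: algebra_simps)
qed

lemma of_nat_CHAR_minus_3_choose:
  assumes "k + 3 \<le> CHAR('a::field)"
  shows "of_nat ((CHAR('a) - 3) choose k) / of_nat (k + 1) = (- of_nat ((CHAR('a) - 2) choose Suc k) / 2 :: 'a)"
    and "of_nat ((CHAR('a) - 3) choose k) / of_nat (k + 2) = (of_nat ((CHAR('a) - 2) choose k) / 2 :: 'a)"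
proof -
  define n where "n = CHAR('a) - 3"
  have n: "CHAR('a) - 3 = n" "CHAR('a) - 2 = Suc n" "CHAR('a) - (k + 2) = Suc n - k"
    using assms by (simp_all add: n_def)
  have nonzero: "(2 :: 'a) \<noteq> 0" "of_nat (k + 1) \<noteq> (0 :: 'a)" "of_nat (k + 2) \<noteq> (0 :: 'a)"
    using assms by (intro two_nonzero_if_CHAR_ge_3 of_nat_below_CHAR_nonzero; simp)+
  have Suc_n: "of_nat (Suc n) = (- of_nat 2 :: 'a)" and diff: "of_nat (Suc n - k) = (- of_nat (k + 2) :: 'a)"
    using assms n(2,3) of_nat_CHAR_diff[where 'a='a, of 2] of_nat_CHAR_diff[where 'a='a, of "k + 2"] by simp_all
  have "of_nat (Suc k * (Suc n choose Suc k)) = (of_nat (Suc n * (n choose k)) :: 'a)"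
    by (simp only: Suc_times_binomial)
  hence "of_nat (n choose k) * 2 = - of_nat (Suc n choose Suc k) * (of_nat (k + 1) :: 'a)"
    unfolding of_nat_mult Suc_n by (simp add: eq_neg_iff_add_eq_0 algebra_simps del: binomial_Suc_Suc)
  thus "of_nat ((CHAR('a) - 3) choose k) / of_nat (k + 1) = (- of_nat ((CHAR('a) - 2) choose Suc k) / 2 :: 'a)"
    unfolding n frac_eq_eq[OF nonzero(2,1)] .
  have "of_nat ((Suc n - k) * (Suc n choose k)) = (of_nat (Suc n * (n choose k)) :: 'a)"
    by (simp only: binomial_absorb_comp diff_Suc_1)
  hence "of_nat (n choose k) * 2 = of_nat (Suc n choose k) * (of_nat (k + 2) :: 'a)"
    unfolding of_nat_mult Suc_n diff
    by (simp only: mult_minus_left mult_minus_right neg_equal_iff_equal of_nat_numeral mult.commute)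
  thus "of_nat ((CHAR('a) - 3) choose k) / of_nat (k + 2) = (of_nat ((CHAR('a) - 2) choose k) / 2 :: 'a)"
    unfolding n frac_eq_eq[OF nonzero(3,1)] .
qed

lemma sum_bool_lists_by_count:
  fixes f :: "nat \<Rightarrow> 'b::comm_semiring_1"
  shows "(\<Sum>s | length s = n. f (count_list s True)) = (\<Sum>k\<le>n. of_nat (n choose k) * f k)"
proof (induction n arbitrary: f)
  case (Suc n)
  have lists: "{s :: bool list. length s = Suc n} = Cons True ` {s. length s = n} \<union> Cons False ` {s. length s = n}"
    by (auto simp: length_Suc_conv image_iff)
  have finite: "finite {s :: bool list. length s = n}"
    using finite_lists_length_eq[of "UNIV :: bool set" n] by simp
  have "(\<Sum>s | length s = Suc n. f (count_list s True)) =
      (\<Sum>s | length s = n. f (Suc (count_list s True))) + (\<Sum>s | length s = n. f (count_list s True))"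
    unfolding lists by (subst sum.union_disjoint) (use finite in \<open>auto simp: sum.reindex inj_on_def\<close>)
  also have "\<dots> = (\<Sum>k\<le>n. of_nat (n choose k) * f (Suc k)) + (\<Sum>k\<le>Suc n. of_nat (n choose k) * f k)"
    using Suc.IH[of "\<lambda>k. f (Suc k)"] Suc.IH[of f] by (simp add: binomial_eq_0)
  also have "\<dots> = (\<Sum>k\<le>Suc n. of_nat (Suc n choose k) * f k)"
    by (simp add: sum.atMost_Suc_shift sum.distrib algebra_simps del: sum.atMost_Suc)
  finally show ?case .
qed simp

section \<open>Expansion in the basis\<close>

lemma e_eq_0: "k \<notin> {1..CHAR('a)} \<Longrightarrow> e k = (0 :: 'a::field m0)"
  by (rule m0_eqI) (auto simp: coord_e)

lemma m0_expansion: "g = (\<Sum>i = 1..CHAR('a). m0_scale (coord g i) (e i :: 'a::field m0))"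
proof (rule m0_eqI)
  fix j
  have "coord (\<Sum>i = 1..CHAR('a). m0_scale (coord g i) (e i :: 'a m0)) j =
      (\<Sum>i = 1..CHAR('a). if j = i then coord g i else 0)"
    unfolding coord_sum by (intro sum.cong) (auto simp: coord_e)
  thus "coord g j = coord (\<Sum>i = 1..CHAR('a). m0_scale (coord g i) (e i :: 'a m0)) j"
    using coord_outside[of j g] by auto
qed

lemma linear_m0_expansion:
  assumes "Vector_Spaces.linear m0_scale (*) (f :: 'a::field m0 \<Rightarrow> 'a)"
  shows "f g = (\<Sum>i = 1..CHAR('a). coord g i * f (e i))"
proof -
  interpret linear: Vector_Spaces.linear m0_scale "(*)" f
    by (rule assms)
  show ?thesis
    by (subst m0_expansion[of g]) (simp only: linear.sum linear.scale)
qed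

lemma bilinear_m0_expansion:
  fixes \<phi> :: "'a::field m0 \<Rightarrow> 'a m0 \<Rightarrow> 'a"
  assumes "\<And>h. Vector_Spaces.linear m0_scale (*) (\<lambda>g. \<phi> g h)" "\<And>g. Vector_Spaces.linear m0_scale (*) (\<phi> g)"
  shows "\<phi> g h = (\<Sum>i = 1..CHAR('a). \<Sum>j = 1..CHAR('a). coord g i * (coord h j * \<phi> (e i) (e j)))"
  by (subst linear_m0_expansion[OF assms(1)], subst linear_m0_expansion[OF assms(2)])
    (simp only: sum_distrib_left)

lemma bilinear_m0_symmetric:
  fixes \<phi> :: "'a::field m0 \<Rightarrow> 'a m0 \<Rightarrow> 'a"
  assumes "\<And>h. Vector_Spaces.linear m0_scale (*) (\<lambda>g. \<phi> g h)" "\<And>g. Vector_Spaces.linear m0_scale (*) (\<phi> g)"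
    and "\<And>i j. i \<in> {1..CHAR('a)} \<Longrightarrow> j \<in> {1..CHAR('a)} \<Longrightarrow> \<phi> (e i) (e j) = \<phi> (e j) (e i)"
  shows "\<phi> g h = \<phi> h g"
proof -
  have "\<phi> g h = (\<Sum>i = 1..CHAR('a). \<Sum>j = 1..CHAR('a). coord g i * (coord h j * \<phi> (e i) (e j)))"
    by (rule bilinear_m0_expansion[OF assms(1,2)])
  also have "\<dots> = (\<Sum>j = 1..CHAR('a). \<Sum>i = 1..CHAR('a). coord h j * (coord g i * \<phi> (e j) (e i)))"
    by (subst sum.swap) (intro sum.cong refl, simp only: assms(3) mult.left_commute)
  also have "\<dots> = \<phi> h g"
    by (rule bilinear_m0_expansion[OF assms(1,2), symmetric])
  finally show ?thesis .
qed

lemma ex_C1_with_values: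
  "\<exists>\<psi> \<in> C1. \<forall>k \<in> {1..CHAR('a)}. \<psi> (e k :: 'a::field m0) = c k"
proof
  define \<psi> where "\<psi> g = (\<Sum>i = 1..CHAR('a). coord g i * c i)" for g :: "'a m0"
  show "\<psi> \<in> C1"
    by (simp add: C1_def linear_m0_iff \<psi>_def sum.distrib sum_distrib_left algebra_simps)
  show "\<forall>k \<in> {1..CHAR('a)}. \<psi> (e k) = c k"
  proof
    fix k assume k: "k \<in> {1..CHAR('a)}"
    hence "\<psi> (e k) = (\<Sum>i = 1..CHAR('a). if k = i then c i else 0)"
      unfolding \<psi>_def by (intro sum.cong) (auto simp: coord_e)
    thus "\<psi> (e k) = c k"
      using k by simp
  qed
qed

lemma C1_zero: "\<psi> \<in> C1 \<Longrightarrow> \<psi> 0 = 0"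
  by (metis C1_def linear_m0_iff m0.scale_zero_left mem_Collect_eq mult_zero_left)

lemma
  assumes "\<phi> \<in> C2"
  shows C2_linear_left: "Vector_Spaces.linear m0_scale (*) (\<lambda>g. \<phi> g h)"
    and C2_linear_right: "Vector_Spaces.linear m0_scale (*) (\<phi> g)"
    and C2_self: "\<phi> g g = 0"
  using assms by (simp_all add: C2_def)

lemma
  assumes "\<phi> \<in> C2"
  shows C2_add_left: "\<phi> (g + g') h = \<phi> g h + \<phi> g' h"
    and C2_add_right: "\<phi> g (h + h') = \<phi> g h + \<phi> g h'"
    and C2_scale_left: "\<phi> (m0_scale c g) h = c * \<phi> g h"
    and C2_scale_right: "\<phi> g (m0_scale c h) = c * \<phi> g h"
    and C2_diff_left: "\<phi> (g - g') h = \<phi> g h - \<phi> g' h"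
    and C2_zero_left: "\<phi> 0 h = 0"
    and C2_zero_right: "\<phi> g 0 = 0"
proof -
  interpret left: Vector_Spaces.linear m0_scale "(*)" "\<lambda>g. \<phi> g h"
    by (rule C2_linear_left[OF assms])
  interpret right: Vector_Spaces.linear m0_scale "(*)" "\<phi> g"
    by (rule C2_linear_right[OF assms])
  show "\<phi> (g + g') h = \<phi> g h + \<phi> g' h" "\<phi> g (h + h') = \<phi> g h + \<phi> g h'"
    "\<phi> (m0_scale c g) h = c * \<phi> g h" "\<phi> g (m0_scale c h) = c * \<phi> g h"
    "\<phi> (g - g') h = \<phi> g h - \<phi> g' h" "\<phi> 0 h = 0" "\<phi> g 0 = 0"
    by (rule left.add right.add left.scale right.scale left.diff left.zero right.zero)+
qed

lemma C2_swap:
  assumes "\<phi> \<in> C2"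
  shows "\<phi> g h = - \<phi> h g"
  using C2_self[OF assms, of "g + h"]
  unfolding C2_add_left[OF assms] C2_add_right[OF assms]
  by (simp add: C2_self[OF assms] eq_neg_iff_add_eq_0 add.commute)

lemma C2_eqI:
  fixes \<phi> \<phi>' :: "'a::field m0 \<Rightarrow> 'a m0 \<Rightarrow> 'a"
  assumes "\<phi> \<in> C2" "\<phi>' \<in> C2"
    and "\<And>i j. 1 \<le> i \<Longrightarrow> i < j \<Longrightarrow> j \<le> CHAR('a) \<Longrightarrow> \<phi> (e i) (e j) = \<phi>' (e i) (e j)"
  shows "\<phi> = \<phi>'"
proof (intro ext)
  fix g h
  have "\<phi> (e i) (e j) = \<phi>' (e i) (e j)" if "i \<in> {1..CHAR('a)}" "j \<in> {1..CHAR('a)}" for i j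
    using that assms(3)[of i j] assms(3)[of j i] C2_self[OF assms(1)] C2_self[OF assms(2)]
      C2_swap[OF assms(1), of "e i" "e j"] C2_swap[OF assms(2), of "e i" "e j"]
    by (cases i j rule: linorder_cases) auto
  thus "\<phi> g h = \<phi>' g h"
    using bilinear_m0_expansion[OF C2_linear_left C2_linear_right, OF assms(1,1), of g h]
      bilinear_m0_expansion[OF C2_linear_left C2_linear_right, OF assms(2,2), of g h]
    by simp
qed

section \<open>The sum in the \<open>*\<close>-property\<close>

lemma left_bracket_snoc: "gs \<noteq> [] \<Longrightarrow> left_bracket (gs @ [x]) = bracket (left_bracket gs) x"
  by (cases gs) (auto simp: left_bracket_def)

lemma coord_left_bracket_Cons_Cons:
  assumes "length gs + 3 \<le> CHAR('a::field)"
  shows "coord (left_bracket (g # h # gs) :: 'a m0) (length gs + 3) =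
    (coord g 1 * coord h 2 - coord g 2 * coord h 1) * (\<Prod>x\<leftarrow>gs. - coord x 1)"
  using assms
proof (induction gs rule: rev_induct)
  case Nil
  thus ?case by (simp add: left_bracket_def coord_bracket)
next
  case (snoc x gs)
  have "coord (left_bracket (g # h # gs)) 1 = 0"
    by (rule coord_left_bracket) auto
  moreover have "left_bracket (g # h # gs @ [x]) = bracket (left_bracket (g # h # gs)) x"
    using left_bracket_snoc[of "g # h # gs" x] by simp
  ultimately show ?case
    using snoc by (simp add: coord_bracket add.commute[of 3])
qed

lemma left_bracket_eq_scale_e_CHAR:
  assumes "length gs + 3 = CHAR('a::field)"
  shows "left_bracket (g # h # gs) = m0_scale
    ((coord g 1 * coord h 2 - coord g 2 * coord h 1) * (\<Prod>x\<leftarrow>gs. - coord x 1)) (e CHAR('a) :: 'a m0)"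
proof (rule m0_eqI)
  fix j
  consider "j \<le> length gs + 2" | "j = length gs + 3" | "j \<notin> {1..CHAR('a)}"
    using assms by force
  thus "coord (left_bracket (g # h # gs)) j = coord (m0_scale
    ((coord g 1 * coord h 2 - coord g 2 * coord h 1) * (\<Prod>x\<leftarrow>gs. - coord x 1)) (e CHAR('a) :: 'a m0)) j"
    using coord_left_bracket[of "g # h # gs" j] coord_left_bracket_Cons_Cons[of gs g h] assms
    by cases (auto simp: coord_e coord_outside)
qed

lemma prod_list_if_eq_power:
  fixes x y :: "'b::comm_monoid_mult"
  shows "(\<Prod>b\<leftarrow>s. if b then x else y) = x ^ count_list s True * y ^ (length s - count_list s True)"
proof (induction s)
  case (Cons b s)
  have "count_list s True \<le> length s"
    by (rule count_le_length)
  thus ?case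
    using Cons by (simp add: Suc_diff_le mult_ac)
qed simp

lemma left_bracket_of_word:
  fixes g h :: "'a::field m0"
  assumes "prime CHAR('a)" "length t + 3 = CHAR('a)"
  shows "left_bracket (g # h # map (\<lambda>b. if b then g else h) t) = m0_scale
    ((coord g 1 * coord h 2 - coord g 2 * coord h 1) *
     (coord g 1 ^ count_list t True * coord h 1 ^ (length t - count_list t True))) (e CHAR('a))"
proof -
  have "(-1 :: 'a) ^ (length t + 3) = - 1"
    using minus_power_prime_CHAR[of "length t + 3" "1 :: 'a"] assms by simp
  hence sign: "(-1 :: 'a) ^ length t = 1"
    by (simp add: power_add)
  have "(\<Prod>x\<leftarrow>map (\<lambda>b. if b then g else h) t. - coord x 1) =
      (\<Prod>b\<leftarrow>t. if b then - coord g 1 else - coord h 1)"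
    unfolding map_map o_def by (intro arg_cong[where f = prod_list] map_cong) auto
  also have "\<dots> = (- coord g 1) ^ count_list t True * (- coord h 1) ^ (length t - count_list t True)"
    by (rule prod_list_if_eq_power)
  also have "\<dots> = (-1) ^ (count_list t True + (length t - count_list t True)) *
      (coord g 1 ^ count_list t True * coord h 1 ^ (length t - count_list t True))"
    by (simp only: power_minus[of "coord g 1"] power_minus[of "coord h 1"] power_add mult_ac)
  also have "count_list t True + (length t - count_list t True) = length t"
    using count_le_length[of t True] by simp
  finally show ?thesis
    using left_bracket_eq_scale_e_CHAR[of "map (\<lambda>b. if b then g else h) t" g h] sign assms(2) by simp
qed

lemma star_sequences_eq:
  "{s. length s = n + 3 \<and> s ! 0 \<and> \<not> s ! 1} =
    (\<lambda>(b, t). True # False # t @ [b]) ` (UNIV \<times> {t. length t = n})" (is "?A = ?f ` ?B")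
proof (intro equalityI subsetI)
  fix s assume "s \<in> ?A"
  then obtain u where u: "s = True # False # u" "length u = Suc n"
    by (auto simp: eval_nat_numeral length_Suc_conv)
  then obtain t b where "u = t @ [b]" "length t = n"
    by (metis length_append_singleton length_Suc_conv_rev nat.inject)
  thus "s \<in> ?f ` ?B"
    using u by auto
qed auto

lemma star_sum_eq_binomial_sum:
  fixes \<phi> :: "'a::field m0 \<Rightarrow> 'a m0 \<Rightarrow> 'a"
  assumes "prime CHAR('a)" "\<phi> \<in> C2" and n: "CHAR('a) = n + 3"
  shows "star_sum \<phi> g h = (coord g 1 * coord h 2 - coord g 2 * coord h 1) *
    (\<phi> (e CHAR('a)) g * (\<Sum>k\<le>n. of_nat (n choose k) / of_nat (k + 2) * (coord g 1 ^ k * coord h 1 ^ (n - k))) +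
     \<phi> (e CHAR('a)) h * (\<Sum>k\<le>n. of_nat (n choose k) / of_nat (k + 1) * (coord g 1 ^ k * coord h 1 ^ (n - k))))"
proof -
  define det where "det = coord g 1 * coord h 2 - coord g 2 * coord h 1"
  define pick where "pick = (\<lambda>b. if b then g else h)"
  define summand where "summand s = 1 / of_nat (count_list s True) *
      \<phi> (left_bracket (butlast (map pick s))) (last (map pick s))" for s
  define outer_count where "outer_count b = (if b then 2 else 1 :: nat)" for b
  define weight where "weight b k = coord g 1 ^ k * coord h 1 ^ (n - k) / of_nat (k + outer_count b)" for b k
  have summand: "summand (True # False # t @ [b]) = det * \<phi> (e CHAR('a)) (pick b) * weight b (count_list t True)"
    if "length t = n" for t b
  proof -
    have "map pick (True # False # t @ [b]) = (g # h # map pick t) @ [pick b]"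
      by (simp add: pick_def)
    moreover have "count_list (True # False # t @ [b]) True = count_list t True + outer_count b"
      by (simp add: outer_count_def)
    ultimately show ?thesis
      unfolding summand_def weight_def
      using left_bracket_of_word[OF assms(1), of t g h, folded pick_def det_def] that n
      by (simp only: butlast_snoc last_snoc C2_scale_left[OF assms(2)]) (simp add: mult_ac)
  qed
  have "star_sum \<phi> g h = sum summand {s. length s = n + 3 \<and> s ! 0 \<and> \<not> s ! 1}"
    by (simp add: star_sum_def summand_def pick_def Let_def n)
  also have "\<dots> = (\<Sum>b\<in>UNIV. \<Sum>t | length t = n. summand (True # False # t @ [b]))"
    unfolding star_sequences_eq
    by (subst sum.reindex) (auto simp: inj_on_def sum.cartesian_product split_def o_def)
  also have "\<dots> = (\<Sum>b\<in>UNIV. \<Sum>t | length t = n. det * \<phi> (e CHAR('a)) (pick b) * weight b (count_list t True))"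
    by (intro sum.cong refl summand) simp
  also have "\<dots> = (\<Sum>b\<in>UNIV. det * \<phi> (e CHAR('a)) (pick b) * (\<Sum>k\<le>n. of_nat (n choose k) * weight b k))"
    unfolding sum_distrib_left[symmetric] sum_bool_lists_by_count ..
  finally show ?thesis
    unfolding det_def[symmetric] by (simp add: UNIV_bool weight_def outer_count_def pick_def algebra_simps)
qed

lemma star_sum_eq_power_diff_quotient:
  fixes \<phi> :: "'a::field m0 \<Rightarrow> 'a m0 \<Rightarrow> 'a"
  assumes "prime CHAR('a)" "3 \<le> CHAR('a)" "\<phi> \<in> C2"
  shows "star_sum \<phi> g h = (coord g 1 * coord h 2 - coord g 2 * coord h 1) / 2 *
    (power_diff_quotient (CHAR('a) - 2) (coord g 1) (coord h 1) * \<phi> (e CHAR('a)) g -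
     power_diff_quotient (CHAR('a) - 2) (coord h 1) (coord g 1) * \<phi> (e CHAR('a)) h)"
proof -
  obtain n where n: "CHAR('a) = n + 3"
    using assms(2) by (metis add.commute le_Suc_ex)
  hence n_simps: "CHAR('a) - 3 = n" "CHAR('a) - 2 = Suc n"
    by simp_all
  note choose = of_nat_CHAR_minus_3_choose[where 'a = 'a, unfolded n_simps]
  have "(\<Sum>k\<le>n. of_nat (n choose k) / of_nat (k + 2) * (x ^ k * y ^ (n - k))) =
      power_diff_quotient (Suc n) x y / 2" for x y :: 'a
    unfolding power_diff_quotient_def sum_divide_distrib lessThan_Suc_atMost
    by (intro sum.cong refl, subst choose(2)) (simp_all add: n mult_ac del: binomial_Suc_Suc)
  moreover have "(\<Sum>k\<le>n. of_nat (n choose k) / of_nat (k + 1) * (x ^ k * y ^ (n - k))) =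
      - power_diff_quotient (Suc n) y x / 2" for x y :: 'a
    unfolding power_diff_quotient_swap[of _ y] sum_divide_distrib lessThan_Suc_atMost sum_negf[symmetric]
    by (intro sum.cong refl, subst choose(1)) (simp_all add: n mult_ac del: binomial_Suc_Suc)
  ultimately show ?thesis
    unfolding star_sum_eq_binomial_sum[OF assms(1,3) n] n_simps
    by (simp only:) (simp add: algebra_simps diff_divide_distrib)
qed

text \<open>
  In characteristic \<open>2\<close> the second summand is \<open>0\<close>, as it should be: there \<open>\<phi>(e\<^sub>2, e\<^sub>p) = 0\<close>, and division by
  \<open>2 = 0\<close> yields \<open>0\<close>.
\<close>

definition star_form :: "('a::field m0 \<Rightarrow> 'a m0 \<Rightarrow> 'a) \<Rightarrow> 'a m0 \<Rightarrow> 'a" where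
  "star_form \<phi> g =
     \<phi> (e 1) (e CHAR('a)) * (coord g 1 ^ (CHAR('a) - 1) * coord g 2) +
     \<phi> (e 2) (e CHAR('a)) / 2 * (coord g 1 ^ (CHAR('a) - 2) * coord g 2 ^ 2)"

lemma star_form_scale:
  assumes "2 \<le> CHAR('a::field)"
  shows "star_form \<phi> (m0_scale c g :: 'a m0) = c ^ CHAR('a) * star_form \<phi> g"
proof -
  obtain n where "CHAR('a) = n + 2"
    using assms by (metis add.commute le_Suc_ex)
  thus ?thesis
    by (simp add: star_form_def power_mult_distrib power2_eq_square algebra_simps)
qed

lemma star_form_e:
  assumes "\<phi> \<in> C2" "2 \<le> CHAR('a::field)"
  shows "star_form \<phi> (e k :: 'a m0) = 0"
proof (cases "CHAR('a) = 2")
  case True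
  thus ?thesis
    using C2_self[OF assms(1)] by (simp add: star_form_def coord_e)
qed (use assms(2) in \<open>auto simp: star_form_def coord_e power_0_left\<close>)

lemma C2_e_CHAR_expansion:
  fixes g :: "'a::field m0"
  assumes "2 \<le> CHAR('a)" "\<phi> \<in> C2"
    and "\<And>j. 3 \<le> j \<Longrightarrow> j \<le> CHAR('a) \<Longrightarrow> \<phi> (e j) (e CHAR('a)) = 0"
  shows "\<phi> (e CHAR('a)) g = - \<phi> (e 1) (e CHAR('a)) * coord g 1 - \<phi> (e 2) (e CHAR('a)) * coord g 2"
proof -
  have "\<phi> g (e CHAR('a)) = (\<Sum>j = 1..CHAR('a). coord g j * \<phi> (e j) (e CHAR('a)))"
    by (rule linear_m0_expansion[OF C2_linear_left[OF assms(2)]])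
  also have "\<dots> = (\<Sum>j\<in>{1, 2}. coord g j * \<phi> (e j) (e CHAR('a)))"
    using assms(1,3) by (intro sum.mono_neutral_right) auto
  finally show ?thesis
    using C2_swap[OF assms(2), of "e CHAR('a)" g] by simp
qed

lemma star_sum_eq_star_form_CHAR_2:
  assumes "CHAR('a::field) = 2" "\<phi> \<in> C2"
  shows "star_sum \<phi> g h = star_form \<phi> (g + h) - star_form \<phi> g - star_form \<phi> (h :: 'a m0)"
proof -
  have "{s. length s = CHAR('a) \<and> s ! 0 \<and> \<not> s ! 1} = {[True, False]}"
    unfolding assms(1) by (auto simp: length_Suc_conv eval_nat_numeral)
  hence "star_sum \<phi> g h = \<phi> g h"
    by (simp add: star_sum_def left_bracket_def)
  also have "\<phi> g h = \<phi> (e 1) (e 2) * (coord g 1 * coord h 2 - coord g 2 * coord h 1)"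
    using bilinear_m0_expansion[OF C2_linear_left[OF assms(2)] C2_linear_right[OF assms(2)], of g h]
      C2_swap[OF assms(2), of "e 2" "e 1"]
    by (simp add: assms(1) numeral_2_eq_2 C2_self[OF assms(2)] algebra_simps)
  also have "\<dots> = \<phi> (e 1) (e 2) * (coord g 1 * coord h 2 + coord g 2 * coord h 1)"
    by (simp only: minus_CHAR_2[OF assms(1)])
  finally show ?thesis
    by (simp add: star_form_def assms(1) C2_self[OF assms(2)] algebra_simps)
qed

lemma star_sum_eq_star_form_CHAR_ge_3:
  fixes \<phi> :: "'a::field m0 \<Rightarrow> 'a m0 \<Rightarrow> 'a"
  assumes "prime CHAR('a)" "3 \<le> CHAR('a)" "\<phi> \<in> C2"
    and "\<And>j. 3 \<le> j \<Longrightarrow> j \<le> CHAR('a) \<Longrightarrow> \<phi> (e j) (e CHAR('a)) = 0"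
  shows "star_sum \<phi> g h = star_form \<phi> (g + h) - star_form \<phi> g - star_form \<phi> h"
proof -
  define n where "n = CHAR('a) - 2"
  define x y u v where "x = coord g 1" "y = coord h 1" "u = coord g 2" "v = coord h 2"
  note xyuv = this
  define a b where "a = \<phi> (e 1) (e CHAR('a))" "b = \<phi> (e 2) (e CHAR('a))"
  define Q where "Q = power_diff_quotient n x y"
  define R where "R = power_diff_quotient n y x"
  have two: "(2::'a) \<noteq> 0"
    using assms(2) by (rule two_nonzero_if_CHAR_ge_3)
  have n: "CHAR('a) - 1 = Suc n"
    using assms(2) by (simp add: n_def)
  have Q: "y * Q = (x + y) ^ n - x ^ n" and R: "x * R = (x + y) ^ n - y ^ n"
    and QR: "x * Q + y * R = - 2 * (x + y) ^ n"
    unfolding Q_def R_def n_def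
    by (simp_all add: mult_power_diff_quotient power_diff_quotient_CHAR_minus_2_add[OF assms(1)] add.commute)
  have QR_x: "x * (x * Q - y * R) = 2 * (y ^ Suc n - (x + y) ^ Suc n)"
    unfolding Q_def R_def n_def by (rule power_diff_quotient_CHAR_minus_2_diff[OF assms(1)])
  have QR_y: "y * (y * R - x * Q) = 2 * (x ^ Suc n - (x + y) ^ Suc n)"
    unfolding Q_def R_def n_def add.commute[of x] by (rule power_diff_quotient_CHAR_minus_2_diff[OF assms(1)])
  have "\<phi> (e CHAR('a)) k = - a * coord k 1 - b * coord k 2" for k
    unfolding a_b_def using assms(2) by (intro C2_e_CHAR_expansion assms(3,4)) simp_all
  hence "2 * star_sum \<phi> g h = (x * v - u * y) * (Q * (- a * x - b * u) - R * (- a * y - b * v))"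
    unfolding star_sum_eq_power_diff_quotient[OF assms(1-3)] using two
    by (simp add: xyuv Q_def R_def n_def)
  also have "\<dots> = - a * (v * (x * (x * Q - y * R)) + u * (y * (y * R - x * Q))) +
      b * (u\<^sup>2 * (y * Q) + v\<^sup>2 * (x * R) - u * v * (x * Q + y * R))"
    by (simp add: algebra_simps power2_eq_square)
  also have "\<dots> = 2 * (star_form \<phi> (g + h) - star_form \<phi> g - star_form \<phi> h)"
    unfolding QR_x QR_y Q R QR star_form_def n n_def[symmetric] coord_simps xyuv[symmetric] a_b_def[symmetric]
    using two by (simp add: algebra_simps power2_eq_square)
  finally show ?thesis
    unfolding mult_left_cancel[OF two] .
qed

lemma star_property_star_form:
  fixes \<phi> :: "'a::field m0 \<Rightarrow> 'a m0 \<Rightarrow> 'a"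
  assumes "prime CHAR('a)" "\<phi> \<in> C2"
    and "\<And>j. 3 \<le> j \<Longrightarrow> j \<le> CHAR('a) \<Longrightarrow> \<phi> (e j) (e CHAR('a)) = 0"
  shows "star_property \<phi> (star_form \<phi>)"
proof -
  have p: "2 \<le> CHAR('a)"
    using assms(1) by (rule prime_ge_2_nat)
  hence "CHAR('a) = 2 \<or> 3 \<le> CHAR('a)"
    by auto
  hence "star_sum \<phi> g h = star_form \<phi> (g + h) - star_form \<phi> g - star_form \<phi> h" for g h
    using star_sum_eq_star_form_CHAR_2[OF _ assms(2)] star_sum_eq_star_form_CHAR_ge_3[OF assms(1) _ assms(2,3)]
    by blast
  thus ?thesis
    by (simp add: star_property_def star_form_scale[OF p])
qed

section \<open>Cocycles\<close>

definition ad_e1 :: "'a::field m0 \<Rightarrow> 'a m0" where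
  "ad_e1 = bracket (e 1)"

lemma ad_e1_e_1: "ad_e1 (e 1) = 0"
  unfolding ad_e1_def by (rule bracket_e_eq_0) simp_all

lemma ad_e1_e:
  assumes "2 \<le> i"
  shows "ad_e1 (e i) = (e (i + 1) :: 'a::field m0)"
  by (rule m0_eqI) (use assms in \<open>auto simp: ad_e1_def coord_bracket coord_e\<close>)

lemma ad_e1_add: "ad_e1 (g + h) = ad_e1 g + (ad_e1 h :: 'a::field m0)"
  and ad_e1_scale: "ad_e1 (m0_scale c g) = m0_scale c (ad_e1 g)"
  by (rule m0_eqI; simp add: ad_e1_def coord_bracket coord_e algebra_simps)+

lemma bracket_eq_ad_e1:
  "bracket g h = m0_scale (coord g 1) (ad_e1 h) - m0_scale (coord h 1) (ad_e1 g :: 'a::field m0)"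
  by (rule m0_eqI) (auto simp: ad_e1_def coord_bracket coord_e algebra_simps)

lemma d2_eq_0_iff:
  fixes \<phi> :: "'a::field m0 \<Rightarrow> 'a m0 \<Rightarrow> 'a"
  assumes "\<phi> \<in> C2"
  shows "d2 \<phi> = 0 \<longleftrightarrow> (\<forall>i\<ge>2. \<forall>j\<ge>2. \<phi> (e (i + 1)) (e j) = \<phi> (e (j + 1)) (e i))"
proof (intro iffI allI impI)
  fix i j :: nat
  assume "d2 \<phi> = 0" and ij: "2 \<le> i" "2 \<le> j"
  hence "d2 \<phi> (e 1) (e i) (e j) = 0"
    by simp
  moreover have "bracket (e i) (e j) = (0 :: 'a m0)"
    using ij by (intro bracket_e_eq_0) auto
  ultimately show "\<phi> (e (i + 1)) (e j) = \<phi> (e (j + 1)) (e i)"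
    unfolding d2_def ad_e1_def[symmetric] ad_e1_e[OF ij(1)] ad_e1_e[OF ij(2)]
    by (simp add: C2_zero_left[OF assms])
next
  assume sym: "\<forall>i\<ge>2. \<forall>j\<ge>2. \<phi> (e (i + 1)) (e j) = \<phi> (e (j + 1)) (e i)"
  (* The subtracted terms cancel in d2 \<phi>; without them \<chi> would not be symmetric. *)
  define \<chi> where "\<chi> g h = \<phi> (ad_e1 g) h - coord h 1 * \<phi> (ad_e1 g) (e 1)" for g h
  have \<chi>_sym: "\<chi> g h = \<chi> h g" for g h
  proof (rule bilinear_m0_symmetric)
    fix i j assume ij: "i \<in> {1..CHAR('a)}" "j \<in> {1..CHAR('a)}"
    hence "i = 1 \<or> 2 \<le> i" "j = 1 \<or> 2 \<le> j"
      by auto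
    thus "\<chi> (e i) (e j) = \<chi> (e j) (e i)"
      using sym ij unfolding \<chi>_def coord_e
      by (auto simp: ad_e1_e_1 ad_e1_e C2_zero_left[OF assms] simp del: One_nat_def)
  qed (simp_all add: linear_m0_iff \<chi>_def ad_e1_add ad_e1_scale C2_add_left[OF assms] C2_add_right[OF assms]
      C2_scale_left[OF assms] C2_scale_right[OF assms] algebra_simps)
  show "d2 \<phi> = 0"
  proof (intro ext)
    fix g h f :: "'a m0"
    have \<phi>: "\<phi> (bracket g h) f = coord g 1 * (\<chi> h f + coord f 1 * \<phi> (ad_e1 h) (e 1)) -
        coord h 1 * (\<chi> g f + coord f 1 * \<phi> (ad_e1 g) (e 1))" for g h f
      unfolding bracket_eq_ad_e1[of g h]
      by (simp add: \<chi>_def C2_diff_left[OF assms] C2_scale_left[OF assms])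
    show "d2 \<phi> g h f = 0 g h f"
      unfolding d2_def \<phi> \<chi>_sym[of f] \<chi>_sym[of h g] by (simp add: algebra_simps)
  qed
qed

lemma d2_e2_1_CHAR: "d2 (e2 1 CHAR('a) :: 'a::field m0 \<Rightarrow> 'a m0 \<Rightarrow> 'a) = 0"
  by (intro ext) (simp add: d2_def e2_def coord_bracket algebra_simps)

lemma e2_in_C2: "e2 i j \<in> C2"
  by (simp add: C2_def linear_m0_iff e2_def algebra_simps)

lemma \<phi>_odd_in_C2: "\<phi>_odd k \<in> C2"
  by (simp add: C2_def linear_m0_iff \<phi>_odd_def e2_def sum.distrib sum_distrib_left algebra_simps sum_subtractf)

lemma \<phi>_odd_e_e:
  assumes "odd k"
  shows "\<phi>_odd k (e i) (e j :: 'a::field m0) =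
    (if {i, j} \<subseteq> {2..CHAR('a)} \<and> i + j = k then (-1) ^ i else 0)"
proof -
  define m where "m = k div 2"
  have k: "k = 2 * m + 1"
    using assms by (simp add: m_def)
  define c where "c a b = (if {a, b} \<subseteq> {1..CHAR('a)} \<and> a + b = k then (-1) ^ a else 0 :: 'a)" for a b
  have half: "(\<Sum>l = 2..m. (-1) ^ l * (coord (e a :: 'a m0) l * coord (e b :: 'a m0) (k - l))) =
      (if a \<in> {2..m} then c a b else 0)" for a b
  proof -
    have "(-1) ^ l * (coord (e a :: 'a m0) l * coord (e b :: 'a m0) (k - l)) = (if l = a then c a b else 0)"
      if "l \<in> {2..m}" for l
      using that k by (auto simp: coord_e c_def)
    thus ?thesis
      by simp
  qed
  have "\<phi>_odd k (e i) (e j :: 'a m0) =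
      (\<Sum>l = 2..m. (-1) ^ l * (coord (e i :: 'a m0) l * coord (e j :: 'a m0) (k - l))) -
      (\<Sum>l = 2..m. (-1) ^ l * (coord (e j :: 'a m0) l * coord (e i :: 'a m0) (k - l)))"
    unfolding \<phi>_odd_def e2_def m_def[symmetric] sum_subtractf[symmetric] by (simp add: algebra_simps)
  also have "\<dots> = (if i \<in> {2..m} then c i j else 0) - (if j \<in> {2..m} then c j i else 0)"
    unfolding half ..
  also have "c j i = - c i j"
    using assms by (auto simp: c_def minus_one_power_iff)
  finally show ?thesis
    using k by (auto simp: c_def)
qed

lemma d2_\<phi>_odd:
  assumes "odd k" "k \<le> CHAR('a::field) + 2"
  shows "d2 (\<phi>_odd k :: 'a m0 \<Rightarrow> 'a m0 \<Rightarrow> 'a) = 0"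
  unfolding d2_eq_0_iff[OF \<phi>_odd_in_C2] \<phi>_odd_e_e[OF assms(1)]
  using assms by (auto simp: minus_one_power_iff)

lemma cocycle_antidiagonal:
  fixes \<phi> :: "'a::field m0 \<Rightarrow> 'a m0 \<Rightarrow> 'a"
  assumes "\<phi> \<in> C2" "d2 \<phi> = 0" "2 \<le> i" "2 \<le> j"
  shows "\<phi> (e i) (e j) = (-1) ^ i * \<phi> (e 2) (e (i + j - 2))"
  using assms(3,4)
proof (induction i arbitrary: j rule: dec_induct)
  case (step i)
  have "\<phi> (e (Suc i)) (e j) = \<phi> (e (j + 1)) (e i)"
    using assms(2) step unfolding d2_eq_0_iff[OF assms(1)] by simp
  also have "\<dots> = - \<phi> (e i) (e (j + 1))"
    by (rule C2_swap[OF assms(1)])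
  finally show ?case
    using step.IH[of "j + 1"] step.prems by simp
qed simp

lemma cocycle_even_antidiagonal:
  fixes \<phi> :: "'a::field m0 \<Rightarrow> 'a m0 \<Rightarrow> 'a"
  assumes "\<phi> \<in> C2" "d2 \<phi> = 0" "2 \<le> j" "even j"
  shows "\<phi> (e 2) (e j) = 0"
proof -
  obtain c where c: "j = 2 * c"
    using assms(4) by blast
  hence "\<phi> (e (c + 1)) (e (c + 1)) = (-1) ^ (c + 1) * \<phi> (e 2) (e j)"
    using cocycle_antidiagonal[OF assms(1,2), of "c + 1" "c + 1"] assms(3) by (simp add: mult_2)
  thus ?thesis
    by (simp add: C2_self[OF assms(1)])
qed

lemma cocycle_last_column:
  assumes "\<phi> \<in> C2" "d2 \<phi> = 0" "3 \<le> j" "j \<le> CHAR('a)"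
  shows "\<phi> (e j) (e CHAR('a) :: 'a::field m0) = 0"
proof -
  have "e (j + CHAR('a) - 2) = (0 :: 'a m0)"
    using assms(3) by (intro e_eq_0) auto
  thus ?thesis
    using cocycle_antidiagonal[OF assms(1,2), of j "CHAR('a)"] assms(3,4) by (simp add: C2_zero_right[OF assms(1)])
qed

lemma cocycle_eq_0_if_e2_eq_0:
  fixes \<phi> :: "'a::field m0 \<Rightarrow> 'a m0 \<Rightarrow> 'a"
  assumes cochain: "\<phi> \<in> C2" and closed: "d2 \<phi> = 0"
    and odd: "\<And>l. odd l \<Longrightarrow> 3 \<le> l \<Longrightarrow> l \<le> CHAR('a) \<Longrightarrow> \<phi> (e 2) (e l) = 0"
    and "2 \<le> i" "2 \<le> j"
  shows "\<phi> (e i) (e j) = 0"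
proof -
  define l where "l = i + j - 2"
  have l: "2 \<le> l"
    using assms(4,5) by (simp add: l_def)
  hence "3 \<le> l" if "odd l"
    using that by (cases "l = 2") auto
  hence "\<phi> (e 2) (e l) = 0"
    using cocycle_even_antidiagonal[OF cochain closed l] odd[of l] e_eq_0[of l, where 'a = 'a]
    by (cases "l \<le> CHAR('a)"; cases "even l") (simp_all add: C2_zero_right[OF cochain])
  thus ?thesis
    using cocycle_antidiagonal[OF cochain closed assms(4,5)] by (simp add: l_def)
qed

lemma d1_in_C2:
  assumes "CHAR('a::field) > 0" "\<psi> \<in> C1"
  shows "d1 \<psi> \<in> (C2 :: ('a m0 \<Rightarrow> 'a m0 \<Rightarrow> 'a) set)"
  using B2_res_subset_Z2_res[OF assms(1)] assms(2) by (auto simp: B2_res_def d1_res_def Z2_res_def C2_res_def)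

lemma cocycle_in_d1_image:
  fixes \<phi> :: "'a::field m0 \<Rightarrow> 'a m0 \<Rightarrow> 'a"
  assumes "CHAR('a) > 0" and cochain: "\<phi> \<in> C2" and closed: "d2 \<phi> = 0"
    and corner: "\<phi> (e 1) (e CHAR('a)) = 0"
    and odd: "\<And>j. odd j \<Longrightarrow> 3 \<le> j \<Longrightarrow> j \<le> CHAR('a) \<Longrightarrow> \<phi> (e 2) (e j) = 0"
  shows "\<phi> \<in> d1 ` C1"
proof -
  obtain \<psi> :: "'a m0 \<Rightarrow> 'a"
    where \<psi>: "\<psi> \<in> C1" and \<psi>_e: "\<And>k. k \<in> {1..CHAR('a)} \<Longrightarrow> \<psi> (e k) = \<phi> (e 1) (e (k - 1))"
    using ex_C1_with_values[of "\<lambda>k. \<phi> (e 1) (e (k - 1))"] by blast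
  have "\<phi> = d1 \<psi>"
  proof (rule C2_eqI[OF cochain d1_in_C2[OF assms(1) \<psi>]])
    fix i j assume ij: "1 \<le> i" "i < j" "j \<le> CHAR('a)"
    consider "i = 1" "j < CHAR('a)" | "i = 1" "j = CHAR('a)" | "2 \<le> i"
      using ij by linarith
    thus "\<phi> (e i) (e j) = d1 \<psi> (e i) (e j)"
    proof cases
      case 1
      thus ?thesis
        using \<psi>_e[of "j + 1"] ij bracket_e1(1)[of j, where 'a = 'a] unfolding d1_def by simp
    next
      case 2
      thus ?thesis
        using corner bracket_e_eq_0[of 1 "CHAR('a)", where 'a = 'a] by (simp add: d1_def C1_zero[OF \<psi>])
    next
      case 3
      have "\<phi> (e i) (e j) = 0"
        using ij 3 by (intro cocycle_eq_0_if_e2_eq_0[OF cochain closed odd]) simp_all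
      thus ?thesis
        using bracket_e_eq_0[of i j, where 'a = 'a] ij 3 by (simp add: d1_def C1_zero[OF \<psi>])
    qed
  qed
  thus ?thesis
    using \<psi> by blast
qed

section \<open>The maps with the \<open>*\<close>-property\<close>

lemma star_property_unique:
  fixes \<omega> \<omega>' :: "'a::field m0 \<Rightarrow> 'a"
  assumes "CHAR('a) > 0" "star_property \<phi> \<omega>" "star_property \<phi> \<omega>'"
    and "\<And>k. k \<in> {1..CHAR('a)} \<Longrightarrow> \<omega> (e k) = \<omega>' (e k)"
  shows "\<omega> = \<omega>'"
proof
  fix g
  define \<delta> where "\<delta> x = \<omega> x - \<omega>' x" for x
  have add: "\<delta> (x + y) = \<delta> x + \<delta> y" and scale: "\<delta> (m0_scale c x) = c ^ CHAR('a) * \<delta> x" for x y c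
    using assms(2,3) by (simp_all add: \<delta>_def star_property_def algebra_simps)
  have zero: "\<delta> 0 = 0"
    using scale[of 0 0] assms(1) by (simp add: power_0_left)
  have sum: "\<delta> (sum f A) = (\<Sum>a\<in>A. \<delta> (f a))" for f and A :: "nat set"
    by (induction A rule: infinite_finite_induct) (simp_all add: zero add)
  have "\<delta> g = (\<Sum>i = 1..CHAR('a). coord g i ^ CHAR('a) * \<delta> (e i))"
    by (subst m0_expansion[of g]) (simp only: sum scale)
  also have "\<dots> = 0"
    using assms(4) by (intro sum.neutral) (simp add: \<delta>_def)
  finally show "\<omega> g = \<omega>' g"
    by (simp add: \<delta>_def)
qed

lemma tilde_cocycle_eq_star_form:
  fixes \<phi> :: "'a::field m0 \<Rightarrow> 'a m0 \<Rightarrow> 'a"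
  assumes "prime CHAR('a)" "\<phi> \<in> C2" "d2 \<phi> = 0"
  shows "tilde \<phi> = star_form \<phi>"
  unfolding tilde_def
proof (rule the_equality)
  show "star_property \<phi> (star_form \<phi>) \<and> (\<forall>k \<in> {1..CHAR('a)}. star_form \<phi> (e k) = 0)"
    using star_property_star_form[OF assms(1,2) cocycle_last_column[OF assms(2,3)]]
      star_form_e[OF assms(2) prime_ge_2_nat[OF assms(1)]] by blast
  thus "\<omega> = star_form \<phi>" if "star_property \<phi> \<omega> \<and> (\<forall>k \<in> {1..CHAR('a)}. \<omega> (e k) = 0)" for \<omega>
    using that star_property_unique[OF prime_gt_0_nat[OF assms(1)]] by metis
qed

lemma
  fixes \<phi> :: "'a::field m0 \<Rightarrow> 'a m0 \<Rightarrow> 'a"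
  assumes "prime CHAR('a)" "\<phi> \<in> C2" "d2 \<phi> = 0"
  shows star_property_tilde: "star_property \<phi> (tilde \<phi>)"
    and tilde_e: "tilde \<phi> (e k) = 0"
  unfolding tilde_cocycle_eq_star_form[OF assms]
  using star_property_star_form[OF assms(1,2) cocycle_last_column[OF assms(2,3)]]
    star_form_e[OF assms(2) prime_ge_2_nat[OF assms(1)]] by auto

section \<open>Biorthogonal families\<close>

lemma vector_space_times: "vector_space ((*) :: 'a::field \<Rightarrow> 'a \<Rightarrow> 'a)"
  by standard (simp_all add: algebra_simps)

lemma (in vector_space)
  fixes b :: "'i \<Rightarrow> 'b" and f :: "'i \<Rightarrow> 'b \<Rightarrow> 'a"
  assumes linear: "\<And>i. i \<in> I \<Longrightarrow> Vector_Spaces.linear scale (*) (f i)"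
    and dual: "\<And>i j. i \<in> I \<Longrightarrow> j \<in> I \<Longrightarrow> f i (b j) = (if i = j then 1 else 0)"
  shows inj_on_biorthogonal: "inj_on b I"
    and independent_biorthogonal: "independent (b ` I)"
proof -
  show "inj_on b I"
    by (rule inj_onI) (metis dual zero_neq_one)
  show "independent (b ` I)"
  proof
    assume "dependent (b ` I)"
    then obtain i where i: "i \<in> I" "b i \<in> span (b ` I - {b i})"
      unfolding dependent_def by blast
    interpret f: Vector_Spaces.linear scale "(*)" "f i"
      by (rule linear[OF i(1)])
    have "b ` I - {b i} \<subseteq> {x. f i x = 0}"
      using i(1) dual by auto
    hence "span (b ` I - {b i}) \<subseteq> {x. f i x = 0}"
      by (rule span_minimal) (rule f.subspace_kernel)
    thus False
      using i dual[of i i] by auto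
  qed
qed

section \<open>Restricted cocycles and coboundaries\<close>

lemma pmap_zero: "pmap (\<lambda>_. 0) g = (0 :: 'a::field m0)"
  by (simp add: pmap_def)

lemma Z2_res_zero_iff:
  "x \<in> Z2_res (\<lambda>_. 0) \<longleftrightarrow> fst x \<in> C2 \<and> star_property (fst x) (snd x) \<and> d2 (fst x) = 0"
  unfolding Z2_res_def C2_res_def d2_res_def
  by (auto simp: ind2_def pmap_zero fun_eq_iff zero_prod_def C2_zero_right)

lemma d1_res_zero: "\<psi> \<in> C1 \<Longrightarrow> d1_res (\<lambda>_. 0) \<psi> = (d1 \<psi>, 0)"
  by (simp add: d1_res_def ind1_def pmap_zero C1_zero fun_eq_iff)

lemma B2_res_zero_eq: "B2_res (\<lambda>_. 0) = (\<lambda>\<psi>. (d1 \<psi>, 0)) ` C1"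
  unfolding B2_res_def by (rule image_cong) (simp_all add: d1_res_zero)

datatype basis_index = Frobenius nat | Corner | Antidiagonal nat

definition basis_indices :: "nat \<Rightarrow> basis_index set" where
  "basis_indices p = Frobenius ` {1..p} \<union> {Corner} \<union> Antidiagonal ` {k. odd k \<and> 5 \<le> k \<and> k \<le> p + 2}"

fun basis_cocycle :: "basis_index \<Rightarrow> 'a::field cochain2" where
  "basis_cocycle (Frobenius k) = (0, ebar k)"
| "basis_cocycle Corner = (e2 1 CHAR('a), tilde (e2 1 CHAR('a)))"
| "basis_cocycle (Antidiagonal k) = (\<phi>_odd k, tilde (\<phi>_odd k))"

fun dual_functional :: "basis_index \<Rightarrow> 'a::field cochain2 \<Rightarrow> 'a" where
  "dual_functional (Frobenius k) x = snd x (e k)"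
| "dual_functional Corner x = fst x (e 1) (e CHAR('a))"
| "dual_functional (Antidiagonal k) x = fst x (e 2) (e (k - 2))"

lemma basis_cocycle_image:
  "(basis_cocycle ` basis_indices CHAR('a) :: 'a::field cochain2 set) = (\<lambda>k. (0, ebar k)) ` {1..CHAR('a)}
    \<union> {(e2 1 CHAR('a), tilde (e2 1 CHAR('a)))}
    \<union> (\<lambda>k. (\<phi>_odd k, tilde (\<phi>_odd k))) ` {k. odd k \<and> 5 \<le> k \<and> k \<le> CHAR('a) + 2}"
  unfolding basis_indices_def image_Un image_image by simp

lemma finite_basis_indices: "finite (basis_indices p)"
  unfolding basis_indices_def by simp

lemma card_basis_indices: "card (basis_indices p) = p + 1 + (p - 1) div 2"
proof -
  have "{k. odd k \<and> 5 \<le> k \<and> k \<le> p + 2} = (\<lambda>m. 2 * m + 5) ` {..<(p - 1) div 2}" (is "?K = _")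
  proof (intro equalityI subsetI)
    fix k assume "k \<in> ?K"
    moreover from this obtain c where "k = 2 * c + 1"
      by (auto elim: oddE)
    ultimately have "k = 2 * (c - 2) + 5" "c - 2 < (p - 1) div 2"
      by auto
    thus "k \<in> (\<lambda>m. 2 * m + 5) ` {..<(p - 1) div 2}"
      by blast
  qed auto
  hence "card ?K = (p - 1) div 2"
    by (simp add: card_image inj_on_def)
  moreover have "card (Frobenius ` {1..p}) = p" "card (Antidiagonal ` ?K) = card ?K"
    by (simp_all add: card_image inj_on_def)
  moreover have "Frobenius ` {1..p} \<inter> {Corner} = {}"
    "(Frobenius ` {1..p} \<union> {Corner}) \<inter> Antidiagonal ` ?K = {}"
    by auto
  ultimately show ?thesis
    unfolding basis_indices_def by (simp add: card_Un_disjoint)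
qed

lemma linear_dual_functional: "Vector_Spaces.linear scale2 (*) (dual_functional i :: 'a::field cochain2 \<Rightarrow> 'a)"
  by (cases i) (simp_all add: Vector_Spaces.linear_iff cochain2.vector_space_axioms vector_space_times scale2_def)

lemma dual_functional_B2_res:
  assumes "x \<in> B2_res (\<lambda>_. 0)" "i \<in> basis_indices CHAR('a::field)"
  shows "dual_functional i (x :: 'a cochain2) = 0"
proof -
  obtain \<psi> where \<psi>: "\<psi> \<in> C1" "x = (d1 \<psi>, 0)"
    using assms(1) unfolding B2_res_zero_eq by blast
  have "bracket (e 1) (e CHAR('a)) = (0 :: 'a m0)" "3 \<le> j \<Longrightarrow> bracket (e 2) (e j) = (0 :: 'a m0)" for j
    by (rule bracket_e_eq_0; simp)+
  thus ?thesis
    using assms(2) by (auto simp: basis_indices_def \<psi>(2) d1_def C1_zero[OF \<psi>(1)])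
qed

lemma basis_cocycle_in_Z2_res:
  assumes "prime CHAR('a::field)" "i \<in> basis_indices CHAR('a)"
  shows "(basis_cocycle i :: 'a cochain2) \<in> Z2_res (\<lambda>_. 0)"
proof -
  have tilde: "(\<phi>, tilde \<phi>) \<in> Z2_res (\<lambda>_. 0)" if "\<phi> \<in> C2" "d2 \<phi> = 0" for \<phi> :: "'a m0 \<Rightarrow> 'a m0 \<Rightarrow> 'a"
    using that star_property_tilde[OF assms(1)] by (simp add: Z2_res_zero_iff)
  have "star_property 0 (ebar k :: 'a m0 \<Rightarrow> 'a)" for k
    using freshmans_dream[OF assms(1) refl]
    by (simp add: star_property_def star_sum_def ebar_def power_mult_distrib)
  moreover have "(0 :: 'a m0 \<Rightarrow> 'a m0 \<Rightarrow> 'a) \<in> C2" "d2 (0 :: 'a m0 \<Rightarrow> 'a m0 \<Rightarrow> 'a) = 0"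
    by (simp_all add: C2_def linear_m0_iff d2_def fun_eq_iff)
  ultimately have "(0, ebar k) \<in> (Z2_res (\<lambda>_. 0) :: 'a cochain2 set)" for k
    by (simp add: Z2_res_zero_iff)
  thus ?thesis
    using assms(2) tilde[OF e2_in_C2 d2_e2_1_CHAR] tilde[OF \<phi>_odd_in_C2 d2_\<phi>_odd]
    by (auto simp: basis_indices_def)
qed

lemma dual_functional_basis_cocycle:
  assumes "prime CHAR('a::field)" "i \<in> basis_indices CHAR('a)" "j \<in> basis_indices CHAR('a)"
  shows "dual_functional i (basis_cocycle j :: 'a cochain2) = (if i = j then 1 else 0)"
proof (cases j)
  case (Frobenius k)
  thus ?thesis
    using assms by (cases i) (auto simp: basis_indices_def ebar_def coord_e power_0_left)
next
  case Corner
  have "2 \<le> CHAR('a)"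
    using assms(1) by (rule prime_ge_2_nat)
  thus ?thesis
    using Corner assms(2) tilde_e[OF assms(1) e2_in_C2 d2_e2_1_CHAR]
    by (cases i) (auto simp: basis_indices_def e2_def coord_e)
next
  case (Antidiagonal k)
  hence k: "odd k" "5 \<le> k" "k \<le> CHAR('a) + 2"
    using assms(3) by (auto simp: basis_indices_def)
  show ?thesis
    using Antidiagonal k assms(2) tilde_e[OF assms(1) \<phi>_odd_in_C2 d2_\<phi>_odd[OF k(1,3)]]
    by (cases i) (auto simp: basis_indices_def \<phi>_odd_e_e[OF k(1)])
qed

lemma in_B2_res_if_dual_functionals_vanish:
  assumes "CHAR('a::field) > 0" "x \<in> Z2_res (\<lambda>_. 0)"
    and dual: "\<And>i. i \<in> basis_indices CHAR('a) \<Longrightarrow> dual_functional i (x :: 'a cochain2) = 0"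
  shows "x \<in> B2_res (\<lambda>_. 0)"
proof -
  obtain \<phi> \<omega> where x: "x = (\<phi>, \<omega>)"
    by (cases x)
  have \<phi>: "\<phi> \<in> C2" "star_property \<phi> \<omega>" "d2 \<phi> = 0"
    using assms(2) unfolding Z2_res_zero_iff x by auto
  have "\<phi> (e 1) (e CHAR('a)) = 0"
    using dual[of Corner] by (simp add: basis_indices_def x)
  moreover have "\<phi> (e 2) (e j) = 0" if "odd j" "3 \<le> j" "j \<le> CHAR('a)" for j
    using dual[of "Antidiagonal (j + 2)"] that by (simp add: basis_indices_def x)
  ultimately obtain \<psi> where \<psi>: "\<psi> \<in> C1" "\<phi> = d1 \<psi>"
    using cocycle_in_d1_image[OF assms(1) \<phi>(1,3)] by blast
  hence B: "(\<phi>, 0) \<in> B2_res (\<lambda>_. 0)"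
    unfolding B2_res_zero_eq by blast
  hence "star_property \<phi> 0"
    using B2_res_subset_Z2_res[OF assms(1)] Z2_res_zero_iff[of "(\<phi>, 0)"] by auto
  moreover have "\<omega> (e k) = 0" if "k \<in> {1..CHAR('a)}" for k
    using dual[of "Frobenius k"] that by (simp add: basis_indices_def x)
  ultimately have "\<omega> = 0"
    using star_property_unique[OF assms(1) \<phi>(2)] by simp
  thus ?thesis
    using B x by simp
qed

lemma Z2_res_expansion_mod_B2_res:
  assumes "prime CHAR('a::field)" "x \<in> Z2_res (\<lambda>_. 0)"
  shows "x - (\<Sum>i \<in> basis_indices CHAR('a). scale2 (dual_functional i x) (basis_cocycle i :: 'a cochain2)) \<in> B2_res (\<lambda>_. 0)"
    (is "x - ?s \<in> _")
proof (rule in_B2_res_if_dual_functionals_vanish)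
  show "CHAR('a) > 0"
    using assms(1) by (rule prime_gt_0_nat)
  show "x - ?s \<in> Z2_res (\<lambda>_. 0)"
    using assms basis_cocycle_in_Z2_res
    by (intro cochain2.subspace_diff cochain2.subspace_sum cochain2.subspace_scale subspace_Z2_res) auto
  fix j assume j: "j \<in> basis_indices CHAR('a)"
  interpret linear: Vector_Spaces.linear scale2 "(*)" "dual_functional j :: 'a cochain2 \<Rightarrow> 'a"
    by (rule linear_dual_functional)
  have "dual_functional j ?s = (\<Sum>i \<in> basis_indices CHAR('a). if j = i then dual_functional i x else 0)"
    unfolding linear.sum linear.scale
    by (intro sum.cong refl) (simp add: dual_functional_basis_cocycle[OF assms(1) j])
  thus "dual_functional j (x - ?s) = 0"
    using j by (simp add: linear.diff finite_basis_indices)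
qed

lemma
  assumes "prime CHAR('a::field)"
  shows inj_on_basis_cocycle: "inj_on (basis_cocycle :: _ \<Rightarrow> 'a cochain2) (basis_indices CHAR('a))"
    and independent_basis_cocycle:
      "cochain2.independent (basis_cocycle ` basis_indices CHAR('a) :: 'a cochain2 set)"
proof -
  note biorthogonal = linear_dual_functional dual_functional_basis_cocycle[OF assms]
  show "inj_on (basis_cocycle :: _ \<Rightarrow> 'a cochain2) (basis_indices CHAR('a))"
    by (rule cochain2.inj_on_biorthogonal[OF biorthogonal])
  show "cochain2.independent (basis_cocycle ` basis_indices CHAR('a) :: 'a cochain2 set)"
    by (rule cochain2.independent_biorthogonal[OF biorthogonal])
qed

lemma card_basis_cocycles:
  assumes "prime CHAR('a::field)"
  shows "card (basis_cocycle ` basis_indices CHAR('a) :: 'a cochain2 set) = CHAR('a) + 1 + (CHAR('a) - 1) div 2"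
  unfolding card_image[OF inj_on_basis_cocycle[OF assms]] by (rule card_basis_indices)

section \<open>The cohomology space\<close>

lemma cohom_class_add:
  assumes "x \<in> Z2_res (\<lambda>_. 0)" "y \<in> Z2_res (\<lambda>_. 0)"
  shows "cohom_class (x + y) = cohom_class x + cohom_class y"
  using assms by (simp add: plus_H2_res.abs_eq cohomologous_refl)

lemma cohom_class_scale:
  assumes "x \<in> Z2_res (\<lambda>_. 0)"
  shows "cohom_class (scale2 c x) = scale_H2 c (cohom_class x)"
  using assms by (simp add: scale_H2.abs_eq cohomologous_refl)

lemma cohom_class_sum:
  assumes "\<And>a. a \<in> A \<Longrightarrow> f a \<in> Z2_res (\<lambda>_. 0)"
  shows "cohom_class (sum f A) = (\<Sum>a\<in>A. cohom_class (f a))"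
  using assms
proof (induction A rule: infinite_finite_induct)
  case (insert a A)
  thus ?case
    using cochain2.subspace_sum[OF subspace_Z2_res, of A f "\<lambda>_. 0"] by (simp add: cohom_class_add)
qed (simp_all add: zero_H2_res_def)

lemma Rep_H2_res_in_Z2_res: "Rep_H2_res h \<in> Z2_res (\<lambda>_. 0)"
  using Quotient_rep_reflp[OF Quotient_H2_res, of h] by (simp add: cohomologous_def)

lemma cohom_class_Rep_H2_res: "cohom_class (Rep_H2_res h) = h"
  by (rule Quotient_abs_rep[OF Quotient_H2_res])

lemma Rep_H2_res_cohom_class:
  assumes "x \<in> Z2_res (\<lambda>_. 0)"
  shows "Rep_H2_res (cohom_class x) - x \<in> B2_res (\<lambda>_. 0)"
  using cohom_class_eq_iff[OF Rep_H2_res_in_Z2_res assms, of "cohom_class x"] by (simp add: cohom_class_Rep_H2_res)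

lemma Rep_H2_res_add: "Rep_H2_res (g + h) - (Rep_H2_res g + Rep_H2_res h) \<in> B2_res (\<lambda>_. 0)"
  using Rep_H2_res_cohom_class[OF cochain2.subspace_add[OF subspace_Z2_res Rep_H2_res_in_Z2_res Rep_H2_res_in_Z2_res]]
  by (simp add: cohom_class_add Rep_H2_res_in_Z2_res cohom_class_Rep_H2_res)

lemma Rep_H2_res_scale: "Rep_H2_res (scale_H2 c h) - scale2 c (Rep_H2_res h) \<in> B2_res (\<lambda>_. 0)"
  using Rep_H2_res_cohom_class[OF cochain2.subspace_scale[OF subspace_Z2_res Rep_H2_res_in_Z2_res]]
  by (simp add: cohom_class_scale Rep_H2_res_in_Z2_res cohom_class_Rep_H2_res)

lemma dual_functional_cong:
  fixes x y :: "'a::field cochain2"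
  assumes "x - y \<in> B2_res (\<lambda>_. 0)" "i \<in> basis_indices CHAR('a)"
  shows "dual_functional i x = dual_functional i y"
proof -
  interpret linear: Vector_Spaces.linear scale2 "(*)" "dual_functional i :: 'a cochain2 \<Rightarrow> 'a"
    by (rule linear_dual_functional)
  show ?thesis
    using dual_functional_B2_res[OF assms] by (simp add: linear.diff)
qed

lemma linear_dual_functional_Rep_H2_res:
  assumes "i \<in> basis_indices CHAR('a::field)"
  shows "Vector_Spaces.linear scale_H2 (*) (\<lambda>h :: 'a H2_res. dual_functional i (Rep_H2_res h))"
proof -
  interpret linear: Vector_Spaces.linear scale2 "(*)" "dual_functional i :: 'a cochain2 \<Rightarrow> 'a"
    by (rule linear_dual_functional)
  show ?thesis
    unfolding Vector_Spaces.linear_iff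
    using dual_functional_cong[OF Rep_H2_res_add assms] dual_functional_cong[OF Rep_H2_res_scale assms]
    by (simp add: linear.add linear.scale H2.vector_space_axioms vector_space_times)
qed

lemma dual_functional_Rep_H2_res_basis:
  assumes "prime CHAR('a::field)" "i \<in> basis_indices CHAR('a)" "j \<in> basis_indices CHAR('a)"
  shows "dual_functional i (Rep_H2_res (cohom_class (basis_cocycle j :: 'a cochain2))) = (if i = j then 1 else 0)"
  using dual_functional_cong[OF Rep_H2_res_cohom_class[OF basis_cocycle_in_Z2_res[OF assms(1,3)]] assms(2)]
    dual_functional_basis_cocycle[OF assms] by simp

lemma
  assumes "prime CHAR('a::field)"
  shows inj_on_cohom_class_basis: "inj_on cohom_class (basis_cocycle ` basis_indices CHAR('a) :: 'a cochain2 set)"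
    and independent_cohom_class_basis:
      "H2.independent (cohom_class ` (basis_cocycle ` basis_indices CHAR('a) :: 'a cochain2 set))"
proof -
  note biorthogonal = linear_dual_functional_Rep_H2_res dual_functional_Rep_H2_res_basis[OF assms]
  have "inj_on (\<lambda>i. cohom_class (basis_cocycle i :: 'a cochain2)) (basis_indices CHAR('a))"
    by (rule H2.inj_on_biorthogonal[OF biorthogonal])
  thus "inj_on cohom_class (basis_cocycle ` basis_indices CHAR('a) :: 'a cochain2 set)"
    by (auto simp: inj_on_def)
  show "H2.independent (cohom_class ` (basis_cocycle ` basis_indices CHAR('a) :: 'a cochain2 set))"
    unfolding image_image by (rule H2.independent_biorthogonal[OF biorthogonal])
qed

lemma span_cohom_class_basis:
  assumes "prime CHAR('a::field)"
  shows "H2.span (cohom_class ` (basis_cocycle ` basis_indices CHAR('a) :: 'a cochain2 set)) = UNIV"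
proof (intro equalityI subsetI UNIV_I)
  fix h :: "'a H2_res"
  define x where "x = Rep_H2_res h"
  define c where "c i = scale2 (dual_functional i x) (basis_cocycle i)" for i
  have x: "x \<in> Z2_res (\<lambda>_. 0)"
    by (simp add: x_def Rep_H2_res_in_Z2_res)
  have c: "c i \<in> Z2_res (\<lambda>_. 0)" if "i \<in> basis_indices CHAR('a)" for i
    unfolding c_def by (intro cochain2.subspace_scale subspace_Z2_res basis_cocycle_in_Z2_res assms that)
  have sum_c: "(\<Sum>i \<in> basis_indices CHAR('a). c i) \<in> Z2_res (\<lambda>_. 0)"
    by (rule cochain2.subspace_sum[OF subspace_Z2_res c])
  have "h = cohom_class x"
    by (simp add: x_def cohom_class_Rep_H2_res)
  also have "\<dots> = cohom_class (\<Sum>i \<in> basis_indices CHAR('a). c i)"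
    unfolding cohom_class_eq_iff[OF x sum_c] unfolding c_def by (rule Z2_res_expansion_mod_B2_res[OF assms x])
  also have "\<dots> = (\<Sum>i \<in> basis_indices CHAR('a). cohom_class (c i))"
    by (rule cohom_class_sum) (rule c)
  also have "\<dots> = (\<Sum>i \<in> basis_indices CHAR('a). scale_H2 (dual_functional i x) (cohom_class (basis_cocycle i)))"
    unfolding c_def by (intro sum.cong refl cohom_class_scale basis_cocycle_in_Z2_res assms)
  also have "\<dots> \<in> H2.span (cohom_class ` (basis_cocycle ` basis_indices CHAR('a)))"
    by (intro H2.span_sum H2.span_scale H2.span_base imageI)
  finally show "h \<in> H2.span (cohom_class ` (basis_cocycle ` basis_indices CHAR('a) :: 'a cochain2 set))" .
qed

lemma dim_H2_res:
  assumes "prime CHAR('a::field)"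
  shows "H2.dim (UNIV :: 'a H2_res set) = CHAR('a) + 1 + (CHAR('a) - 1) div 2"
  unfolding span_cohom_class_basis[OF assms, symmetric]
    H2.dim_span_eq_card_independent[OF independent_cohom_class_basis[OF assms]]
    card_image[OF inj_on_cohom_class_basis[OF assms]] by (rule card_basis_cocycles[OF assms])

section \<open>Trivial coboundaries\<close>

lemma linear_Rep_H2_res_if_no_coboundaries:
  assumes "B2_res (\<lambda>_. 0) = {0 :: 'a::field cochain2}"
  shows "Vector_Spaces.linear scale_H2 scale2 (Rep_H2_res :: 'a H2_res \<Rightarrow> 'a cochain2)"
  unfolding Vector_Spaces.linear_iff
  using H2.vector_space_axioms cochain2.vector_space_axioms
    Rep_H2_res_add[where 'a='a] Rep_H2_res_scale[where 'a='a] by (simp add: assms)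

lemma bij_betw_Rep_H2_res_if_no_coboundaries:
  assumes "B2_res (\<lambda>_. 0) = {0 :: 'a::field cochain2}"
  shows "bij_betw Rep_H2_res UNIV (Z2_res (\<lambda>_. 0) :: 'a cochain2 set)"
proof (rule bij_betw_byWitness[where f' = cohom_class])
  show "\<forall>x \<in> Z2_res (\<lambda>_. 0). Rep_H2_res (cohom_class x) = (x :: 'a cochain2)"
    using Rep_H2_res_cohom_class[where 'a='a] by (simp add: assms)
qed (use Rep_H2_res_in_Z2_res in \<open>auto simp: cohom_class_Rep_H2_res\<close>)

lemma Z2_res_eq_span_basis_cocycle_if_no_coboundaries:
  assumes "prime CHAR('a::field)" "B2_res (\<lambda>_. 0) = {0 :: 'a cochain2}"
  shows "Z2_res (\<lambda>_. 0) = cochain2.span (basis_cocycle ` basis_indices CHAR('a) :: 'a cochain2 set)"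
proof (intro equalityI subsetI)
  fix x :: "'a cochain2" assume "x \<in> Z2_res (\<lambda>_. 0)"
  hence "x = (\<Sum>i \<in> basis_indices CHAR('a). scale2 (dual_functional i x) (basis_cocycle i))"
    using Z2_res_expansion_mod_B2_res[OF assms(1), of x] by (simp add: assms(2))
  also have "\<dots> \<in> cochain2.span (basis_cocycle ` basis_indices CHAR('a))"
    by (intro cochain2.span_sum cochain2.span_scale cochain2.span_base imageI)
  finally show "x \<in> cochain2.span (basis_cocycle ` basis_indices CHAR('a))" .
next
  show "x \<in> Z2_res (\<lambda>_. 0)" if "x \<in> cochain2.span (basis_cocycle ` basis_indices CHAR('a))" for x :: "'a cochain2"
    using cochain2.span_minimal[OF image_subsetI subspace_Z2_res] basis_cocycle_in_Z2_res[OF assms(1)] that by blast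
qed

lemma dim_Z2_res_if_no_coboundaries:
  assumes "prime CHAR('a::field)" "B2_res (\<lambda>_. 0) = {0 :: 'a cochain2}"
  shows "cochain2.dim (Z2_res (\<lambda>_. 0) :: 'a cochain2 set) = CHAR('a) + 1 + (CHAR('a) - 1) div 2"
  unfolding Z2_res_eq_span_basis_cocycle_if_no_coboundaries[OF assms]
    cochain2.dim_span_eq_card_independent[OF independent_basis_cocycle[OF assms(1)]]
  by (rule card_basis_cocycles[OF assms(1)])

lemma bracket_CHAR_2:
  assumes "CHAR('a::field) = 2"
  shows "bracket g h = (0 :: 'a m0)"
  by (rule m0_eqI) (auto simp: coord_bracket assms)

lemma Z2_res_CHAR_2:
  assumes "CHAR('a::field) = 2"
  shows "Z2_res (\<lambda>_. 0) = (C2_res :: 'a cochain2 set)"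
proof -
  have "d2 \<phi> = 0" if "\<phi> \<in> C2" for \<phi> :: "'a m0 \<Rightarrow> 'a m0 \<Rightarrow> 'a"
    by (simp add: fun_eq_iff d2_def bracket_CHAR_2[OF assms] C2_zero_left[OF that])
  thus ?thesis
    by (auto simp: Z2_res_zero_iff C2_res_def)
qed

lemma B2_res_CHAR_2:
  assumes "CHAR('a::field) = 2"
  shows "B2_res (\<lambda>_. 0) = {0 :: 'a cochain2}"
proof -
  have "(d1 \<psi>, 0) = (0 :: 'a cochain2)" if "\<psi> \<in> C1" for \<psi>
    using that by (simp add: zero_prod_def fun_eq_iff d1_def bracket_CHAR_2[OF assms] C1_zero)
  moreover have "0 \<in> B2_res (\<lambda>_. 0)"
    by (rule cochain2.subspace_0[OF subspace_B2_res])
  ultimately show ?thesis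
    unfolding B2_res_zero_eq by auto
qed

lemma basis_cocycle_image_CHAR_2:
  assumes "CHAR('a::field) = 2"
  shows "(basis_cocycle ` basis_indices CHAR('a) :: 'a cochain2 set) =
    {(0, ebar 1), (0, ebar 2), (e2 1 2, tilde (e2 1 2))}"
proof -
  have "{1..2::nat} = {1, 2}" "{k. odd k \<and> 5 \<le> k \<and> k \<le> (2::nat) + 2} = {}"
    by auto
  thus ?thesis
    unfolding basis_cocycle_image unfolding assms by auto
qed

theorem theorem4p2:
  fixes p :: nat
  assumes "prime p" and "CHAR('a::field) = p"
  shows
    "(p = 2 \<longrightarrow>
        (\<exists>f :: 'a H2_res \<Rightarrow> 'a cochain2.
           Vector_Spaces.linear scale_H2 scale2 f \<and> bij_betw f UNIV C2_res) \<and>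
        (C2_res :: 'a cochain2 set) =
          cochain2.span {(0, ebar 1), (0, ebar 2), (e2 1 2, tilde (e2 1 2))} \<and>
        cochain2.dim (C2_res :: 'a cochain2 set) = 3 \<and>
        H2.dim (UNIV :: 'a H2_res set) = 3) \<and>
     (p \<ge> 3 \<longrightarrow>
        real (H2.dim (UNIV :: 'a H2_res set)) = (3 * real p + 1) / 2 \<and>
        (let R = (\<lambda>k. (0, ebar k)) ` {1..p}
                 \<union> {(e2 1 p, tilde (e2 1 p))}
                 \<union> (\<lambda>k. (\<phi>_odd k, tilde (\<phi>_odd k))) ` {k. odd k \<and> 5 \<le> k \<and> k \<le> p + 2}
         in R \<subseteq> Z2_res (\<lambda>_. 0) \<and>
            inj_on cohom_class R \<and>
            H2.independent (cohom_class ` R) \<and>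
            H2.span (cohom_class ` R) = (UNIV :: 'a H2_res set)))"
proof (unfold Let_def basis_cocycle_image[where 'a='a, unfolded assms(2), symmetric], intro conjI impI)
  let ?R = "basis_cocycle ` basis_indices p :: 'a cochain2 set"
  have prime: "prime CHAR('a)"
    using assms by simp
  show "?R \<subseteq> Z2_res (\<lambda>_. 0)"
    using basis_cocycle_in_Z2_res[OF prime] unfolding assms(2) by blast
  show "inj_on cohom_class ?R" "H2.independent (cohom_class ` ?R)" "H2.span (cohom_class ` ?R) = UNIV"
    using inj_on_cohom_class_basis[OF prime] independent_cohom_class_basis[OF prime]
      span_cohom_class_basis[OF prime] unfolding assms(2) .
  show "real (H2.dim (UNIV :: 'a H2_res set)) = (3 * real p + 1) / 2" if "3 \<le> p"
    using prime_odd_nat[OF assms(1)] that unfolding dim_H2_res[OF prime] assms(2) by (auto elim!: oddE)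
  assume "p = 2"
  hence char: "CHAR('a) = 2"
    using assms(2) by simp
  note B2 = B2_res_CHAR_2[OF char] and Z2 = Z2_res_CHAR_2[OF char]
  show "\<exists>f :: 'a H2_res \<Rightarrow> 'a cochain2. Vector_Spaces.linear scale_H2 scale2 f \<and> bij_betw f UNIV C2_res"
    using linear_Rep_H2_res_if_no_coboundaries[OF B2] bij_betw_Rep_H2_res_if_no_coboundaries[OF B2] unfolding Z2 by blast
  show "C2_res = cochain2.span {(0, ebar 1), (0, ebar 2), (e2 1 2, tilde (e2 1 2)) :: 'a cochain2}"
    using Z2_res_eq_span_basis_cocycle_if_no_coboundaries[OF prime B2] unfolding Z2 basis_cocycle_image_CHAR_2[OF char] .
  show "cochain2.dim (C2_res :: 'a cochain2 set) = 3" "H2.dim (UNIV :: 'a H2_res set) = 3"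
    using dim_Z2_res_if_no_coboundaries[OF prime B2] dim_H2_res[OF prime] unfolding Z2 char by simp_all
qed

end
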